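(* There is a monotone graph property $\mathcal{P}$ with $1$-sided error query complexity $w_{\mathcal{P}}(\varepsilon)=2^{\Theta(1/\varepsilon)}$.
   Context: A graph property is monotone if it is closed under removal of vertices and edges. An $n$-vertex graph $G$ is $\varepsilon$-far from $\mathcal{P}$ if one must remove at least $\varepsilon n^2$ edges from $G$ to make it satisfy $\mathcal{P}$. For a monotone graph property $\mathcal{P}$ and $\varepsilon\in(0,1)$, $w_{\mathcal{P}}(\varepsilon)$ is the smallest positive integer $w$ such that for every sufficiently large graph $G$ which is $\varepsilon$-far from satisfying $\mathcal{P}$, a uniformly random set $S$ of $w$ vertices of $G$ is such that the induced subgraph $G[S]$ does not satisfy $\mathcal{P}$ with probability at least $2/3$. For monotone $\mathcal{P}$ this quantity equals the $1$-sided error query complexity of $\mathcal{P}$, that is, the sample size of the optimal $\varepsilon$-tester which samples a uniformly random vertex set, decides on the basis of the induced subgraph, accepts every graph satisfying $\mathcal{P}$ with probability $1$, and rejects every graph that is $\varepsilon$-far from $\mathcal{P}$ with probability at least $2/3$. The constants implicit in the $\Theta$-notation are absolute and positive. *)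

theory Defs
  imports
    "HOL-Probability.Probability"
    "HOL-Library.Landau_Symbols"
    "HOL-Library.Ramsey"
begin

text \<open>
  Vertices are natural numbers; as graph properties are required to be invariant under
  isomorphism, this covers all finite graphs.
\<close>

type_synonym graph = "nat set \<times> nat set set"

abbreviation verts :: "graph \<Rightarrow> nat set" where
  "verts G \<equiv> fst G"

abbreviation edges :: "graph \<Rightarrow> nat set set" where
  "edges G \<equiv> snd G"

definition simple_graph :: "graph \<Rightarrow> bool" where
  "simple_graph G \<longleftrightarrow> finite (verts G) \<and> edges G \<subseteq> nsets (verts G) 2"

definition isomorphic :: "graph \<Rightarrow> graph \<Rightarrow> bool" where
  "isomorphic G H \<longleftrightarrow>
     (\<exists>f. bij_betw f (verts G) (verts H) \<and> edges H = (\<lambda>e. f ` e) ` edges G)"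

definition remove_verts :: "graph \<Rightarrow> nat set \<Rightarrow> graph" where
  "remove_verts G W = (verts G - W, {e \<in> edges G. e \<inter> W = {}})"

definition remove_edges :: "graph \<Rightarrow> nat set set \<Rightarrow> graph" where
  "remove_edges G F = (verts G, edges G - F)"

definition induced_subgraph :: "graph \<Rightarrow> nat set \<Rightarrow> graph" where
  "induced_subgraph G S = (S, {e \<in> edges G. e \<subseteq> S})"

definition graph_property :: "graph set \<Rightarrow> bool" where
  "graph_property P \<longleftrightarrow>
     (\<forall>G\<in>P. simple_graph G) \<and>
     (\<forall>G\<in>P. \<forall>H. simple_graph H \<and> isomorphic G H \<longrightarrow> H \<in> P)"

definition monotone_graph_property :: "graph set \<Rightarrow> bool" where
  "monotone_graph_property P \<longleftrightarrow>
     graph_property P \<and>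
     (\<forall>G\<in>P. \<forall>W. remove_verts G W \<in> P) \<and>
     (\<forall>G\<in>P. \<forall>F. remove_edges G F \<in> P)"

definition far_from :: "real \<Rightarrow> graph set \<Rightarrow> graph \<Rightarrow> bool" where
  "far_from \<epsilon> P G \<longleftrightarrow>
     (\<forall>F \<subseteq> edges G. remove_edges G F \<in> P \<longrightarrow> real (card F) \<ge> \<epsilon> * (real (card (verts G)))\<^sup>2)"

text \<open>
  The distribution \<^term>\<open>pmf_of_set (nsets (verts G) w)\<close> is meaningful only if \<open>G\<close> has at least
  \<open>w\<close> vertices; as the threshold \<open>n\<^sub>0\<close> may be chosen to be at least \<open>w\<close>, smaller graphs
  have no influence.
\<close>

definition sample_size_suffices :: "graph set \<Rightarrow> real \<Rightarrow> nat \<Rightarrow> bool" where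
  "sample_size_suffices P \<epsilon> w \<longleftrightarrow>
     (\<exists>n\<^sub>0. \<forall>G. simple_graph G \<and> card (verts G) \<ge> n\<^sub>0 \<and> far_from \<epsilon> P G \<longrightarrow>
        measure_pmf.prob (pmf_of_set (nsets (verts G) w)) {S. induced_subgraph G S \<notin> P} \<ge> 2/3)"

text \<open>
  The value is unspecified if no sample size suffices, so statements about it should also
  assert that some positive \<open>w\<close> with \<^term>\<open>sample_size_suffices P \<epsilon> w\<close> exists.
\<close>

definition query_complexity :: "graph set \<Rightarrow> real \<Rightarrow> nat" where
  "query_complexity P \<epsilon> = (LEAST w. w > 0 \<and> sample_size_suffices P \<epsilon> w)"

end

theory Submission
  imports Defs "HOL-Combinatorics.Multiset_Permutations"
begin

text \<open>
  The property forbids closed walks of length \<open>2k + 1\<close>, but only in graphs with at least \<open>2\<close> to the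
  power \<open>k\<^sup>2\<close> vertices. The point is that an \<open>\<epsilon>\<close>-far graph always has odd cycles of length
  \<open>O(1/\<surd>\<epsilon>)\<close>, and that this is the right order of magnitude.

  Lower bound: the balanced blow-up of the cycle of length \<open>m = 2k + 1\<close> is \<open>1/m\<^sup>2\<close>-far from the
  property but has no shorter odd closed walk, so every sample of fewer than \<open>2\<close> to the power
  \<open>k\<^sup>2\<close> vertices satisfies the property.

  Upper bound: run a breadth-first search in which a vertex enters the next layer only if it has
  linearly many neighbours in the current one. While all consecutive layers \<open>L\<^sub>i\<close>, \<open>L\<^sub>i\<^sub>+\<^sub>1\<close> span more
  than \<open>\<epsilon> n |ball\<^sub>i|\<close> pairs, the ball has size at least \<open>\<epsilon> n i\<^sup>2 / 4\<close>, hence a cheap cut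
  appears within \<open>O(1/\<surd>\<epsilon>)\<close> layers. Either the pieces cut off are nearly bipartite, or many roots
  have many short odd closed walks. In the latter case the density of tuples containing a closed
  walk is so large that \<open>2\<close> to the power \<open>O(1/\<epsilon>)\<close> sampled vertices contain one.
\<close>

section \<open>Closed walks of odd length\<close>

lemma relpow_mono_rel:
  fixes R S :: "'a rel"
  assumes "R \<subseteq> S"
  shows "R ^^ n \<subseteq> S ^^ n"
  using assms by (induction n) auto

lemma sym_relpow:
  fixes R :: "'a rel"
  assumes "sym R"
  shows "sym (R ^^ n)"
proof (induction n)
  case 0
  show ?case by (auto intro: symI)
next
  case (Suc n)
  show ?case
  proof (rule symI)
    fix x y
    assume "(x, y) \<in> R ^^ Suc n"
    then obtain z where "(x, z) \<in> R ^^ n" "(z, y) \<in> R"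
      by (rule relpow_Suc_E)
    then have "(z, x) \<in> R ^^ n" "(y, z) \<in> R"
      using Suc assms by (auto dest: symD)
    then show "(y, x) \<in> R ^^ Suc n"
      by (rule relpow_Suc_I2[rotated])
  qed
qed

text \<open>A nonempty walk closed at \<open>x\<close> gives \<open>x\<close> a neighbour
  \<open>y\<close>; the detour \<open>x, y, x\<close> can be appended any number of times.\<close>

lemma closed_walk_lengthen:
  fixes R :: "'a rel"
  assumes "sym R" "(x, x) \<in> R ^^ n" "n > 0"
  shows "(x, x) \<in> R ^^ (n + 2 * k)"
proof (induction k)
  case 0
  show ?case using assms by simp
next
  case (Suc k)
  then obtain y where y: "(x, y) \<in> R"
    using assms(3) by (metis add_gr_0 gr0_implies_Suc relpow_Suc_D2)
  then have "(y, x) \<in> R"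
    using assms(1) by (rule symD[rotated])
  with y Suc show ?case
    using relpow_Suc_I[OF relpow_Suc_I] by fastforce
qed

text \<open>For symmetric \<open>A\<close> the one length \<open>2 * r + 1\<close> stands for all
  odd lengths up to it, by \<open>odd_closed_lengthen\<close>. Closed walks, unlike cycles, may
  repeat vertices, so walks can be glued freely.\<close>

definition odd_closed :: "'a rel \<Rightarrow> nat \<Rightarrow> 'a set \<Rightarrow> bool" where
  "odd_closed A r S \<longleftrightarrow> (\<exists>x. (x, x) \<in> (A \<inter> S \<times> S) ^^ (2 * r + 1))"

lemma odd_closed_mono:
  assumes "odd_closed A r S" "S \<subseteq> T"
  shows "odd_closed A r T"
proof -
  have "A \<inter> S \<times> S \<subseteq> A \<inter> T \<times> T" using assms(2) by auto
  then show ?thesis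
    using assms(1) relpow_mono_rel unfolding odd_closed_def by blast
qed

lemma odd_closed_lengthen:
  assumes "sym A" "(x, x) \<in> (A \<inter> S \<times> S) ^^ (2 * j + 1)" "j \<le> r"
  shows "odd_closed A r S"
proof -
  have "sym (A \<inter> S \<times> S)"
    using assms(1) by (auto simp: sym_def)
  from closed_walk_lengthen[OF this assms(2), of "r - j"] assms(3) show ?thesis
    by (auto simp: odd_closed_def algebra_simps)
qed

text \<open>The colour alternates along a walk, so an odd number of steps ends in the other
  colour.\<close>

lemma two_coloured_no_odd_closed_walk:
  fixes R :: "'a rel"
  assumes "\<And>x y. (x, y) \<in> R \<Longrightarrow> c x \<noteq> (c y :: bool)"
  shows "(x, x) \<notin> R ^^ (2 * k + 1)"
proof
  have walk: "(x, y) \<in> R ^^ n \<Longrightarrow> c y = (c x \<noteq> odd n)" for y n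
  proof (induction n arbitrary: y)
    case (Suc n)
    from Suc.prems obtain z where "(x, z) \<in> R ^^ n" "(z, y) \<in> R"
      by (rule relpow_Suc_E)
    with Suc.IH assms show ?case by auto
  qed auto
  assume "(x, x) \<in> R ^^ (2 * k + 1)"
  from walk[OF this] show False by simp
qed

section \<open>Random subsets and random lists\<close>

definition lists_of :: "'a set \<Rightarrow> nat \<Rightarrow> 'a list set" where
  "lists_of V n = {xs. set xs \<subseteq> V \<and> length xs = n}"

lemma finite_lists_of [simp]: "finite V \<Longrightarrow> finite (lists_of V n)"
  by (simp add: lists_of_def finite_lists_length_eq)

lemma card_lists_of: "finite V \<Longrightarrow> card (lists_of V n) = card V ^ n"
  by (simp add: lists_of_def card_lists_length_eq)

text \<open>Cut the list into \<open>q\<close> blocks of length \<open>l\<close>: by monotonicity a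
  list avoiding \<open>Q\<close> avoids it on every block.\<close>

lemma card_lists_avoiding:
  fixes Q :: "'a set \<Rightarrow> bool"
  assumes fin: "finite V"
    and mono: "\<And>S T. Q S \<Longrightarrow> S \<subseteq> T \<Longrightarrow> Q T"
  shows "card {xs \<in> lists_of V (q * l). \<not> Q (set xs)} \<le> card {xs \<in> lists_of V l. \<not> Q (set xs)} ^ q"
proof (induction q)
  case 0
  have "{xs \<in> lists_of V 0. \<not> Q (set xs)} \<subseteq> {[]}"
    by (auto simp: lists_of_def)
  then have "card {xs \<in> lists_of V 0. \<not> Q (set xs)} \<le> card {[] :: 'a list}"
    by (intro card_mono) auto
  then show ?case by simp
next
  case (Suc q)
  let ?B = "\<lambda>n. {xs \<in> lists_of V n. \<not> Q (set xs)}"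
  have "inj_on (\<lambda>xs. (take l xs, drop l xs)) (?B (Suc q * l))"
    by (rule inj_onI) (metis append_take_drop_id prod.inject)
  moreover have "(\<lambda>xs. (take l xs, drop l xs)) ` ?B (Suc q * l) \<subseteq> ?B l \<times> ?B (q * l)"
  proof clarify
    fix xs assume xs: "xs \<in> lists_of V (Suc q * l)" "\<not> Q (set xs)"
    then have "\<not> Q (set (take l xs))" "\<not> Q (set (drop l xs))"
      using mono set_take_subset set_drop_subset by metis+
    with xs show "take l xs \<in> ?B l \<and> drop l xs \<in> ?B (q * l)"
      using set_take_subset set_drop_subset by (fastforce simp: lists_of_def)
  qed
  moreover have "finite (?B l \<times> ?B (q * l))"
    using fin by simp
  ultimately have "card (?B (Suc q * l)) \<le> card (?B l \<times> ?B (q * l))"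
    by (metis (no_types, lifting) card_inj_on_le)
  also have "\<dots> = card (?B l) * card (?B (q * l))"
    by (rule card_cartesian_product)
  also have "\<dots> \<le> card (?B l) * card (?B l) ^ q"
    using Suc by simp
  finally show ?case by simp
qed

lemma card_distinct_lists_set_in:
  assumes "finite V" "\<S> \<subseteq> nsets V w"
  shows "card {xs. distinct xs \<and> set xs \<in> \<S>} = card \<S> * fact w"
proof -
  have fin: "finite \<S>"
    using assms finite_subset finite_imp_finite_nsets by blast
  have "{xs. distinct xs \<and> set xs \<in> \<S>} = (\<Union>S\<in>\<S>. permutations_of_set S)"
    by (auto simp: permutations_of_set_def)
  also have "card \<dots> = (\<Sum>S\<in>\<S>. card (permutations_of_set S))"
    by (rule card_UN_disjoint) (use fin in \<open>auto dest: permutations_of_setD\<close>)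
  also have "\<dots> = (\<Sum>S\<in>\<S>. fact w)"
    by (rule sum.cong) (use assms in \<open>auto simp: nsets_def\<close>)
  finally show ?thesis by simp
qed

text \<open>The falling factorial is at least \<open>(n - w) ^ w\<close>, and Bernoulli's inequality
  bounds the relative loss against \<open>n ^ w\<close> by
  \<open>w ^ 2 / n \<le> 1 / 4\<close>.\<close>

lemma binomial_fact_ge:
  assumes n: "real n \<ge> 4 * real w ^ 2"
  shows "real (n choose w) * fact w \<ge> 3 / 4 * real n ^ w"
proof (cases "w = 0")
  case False
  have "w \<le> w ^ 2" by (simp add: power2_eq_square)
  moreover have "real (4 * w ^ 2) \<le> real n" using n by simp
  ultimately have wn: "w \<le> n" by linarith
  then have npos: "n > 0" using False by simp
  \<comment> \<open>Both sides count the lists of \<open>w\<close> distinct elements of an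
    \<open>n\<close>-set.\<close>
  have "(n choose w) * fact w = \<Prod>{n - w + 1..n}"
    using card_distinct_lists_set_in[of "{..<n}" "nsets {..<n} w" w]
      card_lists_distinct_length_eq[of "{..<n}" w] wn
    by (simp add: nsets_def binomial_eq_nsets lessThan_atLeast0 distinct_card conj_ac cong: conj_cong)
  also have "real \<dots> \<ge> (\<Prod>i\<in>{n - w + 1..n}. real n - real w)"
    unfolding of_nat_prod by (rule prod_mono) (use wn in auto)
  finally have "real ((n choose w) * fact w) \<ge> (real n - real w) ^ w"
    using wn by simp
  moreover have "(real n - real w) ^ w = real n ^ w * (1 + (- (real w / real n))) ^ w"
    using npos by (simp add: power_mult_distrib[symmetric] algebra_simps)
  moreover have "(1 + (- (real w / real n))) ^ w \<ge> 1 + real w * (- (real w / real n))"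
    by (rule Bernoulli_inequality) (use npos wn in auto)
  moreover have "real w * (real w / real n) \<le> 1 / 4"
    using n npos by (simp add: field_simps power2_eq_square)
  ultimately have "real ((n choose w) * fact w) \<ge> real n ^ w * (1 + (- (real w / real n))) ^ w"
    "(1 + (- (real w / real n))) ^ w \<ge> 3 / 4"
    by linarith+
  then have "real ((n choose w) * fact w) \<ge> real n ^ w * (3 / 4)"
    by (meson mult_left_mono of_nat_0_le_iff order_trans zero_le_power)
  then show ?thesis by simp
qed simp

text \<open>A uniformly random set is compared with a uniformly random list, for which disjoint blocks
  are independent.\<close>

lemma prob_subset_hits:
  fixes Q :: "'a set \<Rightarrow> bool"
  assumes fin: "finite V"
    and mono: "\<And>S T. Q S \<Longrightarrow> S \<subseteq> T \<Longrightarrow> Q T"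
    and hits: "real (card {xs \<in> lists_of V l. Q (set xs)}) \<ge> \<delta> * real (card V) ^ l"
    and \<delta>: "0 < \<delta>" and q: "real q \<ge> 2 / \<delta>"
    and large: "real (card V) \<ge> 4 * real (q * l) ^ 2" "card V > 0"
  shows "measure_pmf.prob (pmf_of_set (nsets V (q * l))) {S. Q S} \<ge> 2 / 3"
proof -
  define n where "n = real (card V)"
  define w where "w = q * l"
  have npos: "n > 0" using large n_def by simp
  have cardbad: "real (card {xs \<in> lists_of V l. \<not> Q (set xs)}) \<le> (1 - \<delta>) * n ^ l"
  proof -
    have "card (lists_of V l) =
        card ({xs \<in> lists_of V l. Q (set xs)} \<union> {xs \<in> lists_of V l. \<not> Q (set xs)})"
      by (rule arg_cong[where f = card]) auto
    also have "\<dots> = card {xs \<in> lists_of V l. Q (set xs)} + card {xs \<in> lists_of V l. \<not> Q (set xs)}"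
      by (rule card_Un_disjoint) (use fin in auto)
    finally show ?thesis
      using hits card_lists_of[OF fin, of l] unfolding n_def
      by (simp add: algebra_simps flip: of_nat_power)
  qed
  \<comment> \<open>The number of bad lists is nonnegative, which forces
    \<open>\<delta> \<le> 1\<close>.\<close>
  have "0 \<le> (1 - \<delta>) * n ^ l" using cardbad by (meson of_nat_0_le_iff order_trans)
  moreover have "n ^ l > 0" using npos by simp
  ultimately have \<delta>1: "0 \<le> 1 - \<delta>" by (simp add: zero_le_mult_iff)
  have "(1 - \<delta>) ^ q \<le> exp (- \<delta>) ^ q"
    by (rule power_mono) (use exp_ge_add_one_self[of "- \<delta>"] \<delta>1 in auto)
  also have "\<dots> = exp (- (\<delta> * real q))"
    by (simp flip: exp_of_nat_mult add: mult.commute)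
  also have "\<dots> \<le> exp (- 2)"
    using q \<delta> by (simp add: field_simps)
  also have "\<dots> \<le> 1 / 4"
  proof -
    have "exp (2::real) = exp 1 * exp 1" by (simp flip: exp_add)
    also have "\<dots> \<ge> 2 * 2"
      by (rule mult_mono) (use exp_ge_add_one_self[of "1::real"] in auto)
    finally show ?thesis by (simp add: exp_minus field_simps)
  qed
  finally have pow: "(1 - \<delta>) ^ q \<le> 1 / 4" .
  define \<S> where "\<S> = {S \<in> nsets V w. \<not> Q S}"
  have sub: "\<S> \<subseteq> nsets V w" by (auto simp: \<S>_def)
  have "{xs. distinct xs \<and> set xs \<in> \<S>} \<subseteq> {xs \<in> lists_of V w. \<not> Q (set xs)}"
    by (auto simp: \<S>_def lists_of_def nsets_def distinct_card)
  then have "card {xs. distinct xs \<and> set xs \<in> \<S>} \<le> card {xs \<in> lists_of V w. \<not> Q (set xs)}"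
    by (rule card_mono[rotated]) (use fin in simp)
  then have "card \<S> * fact w \<le> card {xs \<in> lists_of V w. \<not> Q (set xs)}"
    by (simp only: card_distinct_lists_set_in[OF fin sub])
  also have "\<dots> \<le> card {xs \<in> lists_of V l. \<not> Q (set xs)} ^ q"
    unfolding w_def by (rule card_lists_avoiding[OF fin mono])
  finally have "real (card \<S> * fact w) \<le> real (card {xs \<in> lists_of V l. \<not> Q (set xs)}) ^ q"
    by (metis of_nat_le_iff of_nat_power)
  also have "\<dots> \<le> ((1 - \<delta>) * n ^ l) ^ q"
    by (rule power_mono[OF cardbad]) auto
  also have "\<dots> = (1 - \<delta>) ^ q * n ^ w"
    by (simp add: power_mult_distrib w_def mult.commute flip: power_mult)
  also have "\<dots> \<le> 1 / 4 * n ^ w"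
    by (rule mult_right_mono[OF pow]) (use npos in auto)
  \<comment> \<open>Here \<open>1 / 4 = 1 / 3 * (3 / 4)\<close>: the factor \<open>3 / 4\<close>
    accounts for passing from arbitrary to distinct lists, and \<open>1 / 3\<close> remains as
    failure probability.\<close>
  also have "\<dots> \<le> 1 / 3 * (real (card V choose w) * fact w)"
    using binomial_fact_ge[of w "card V"] large(1) by (simp add: n_def w_def)
  finally have "real (card \<S>) * fact w \<le> (1 / 3 * real (card V choose w)) * fact w"
    by simp
  then have bad: "real (card \<S>) \<le> 1 / 3 * real (card V choose w)"
    by simp
  have cardns: "card (nsets V w) = card V choose w"
  proof -
    have "nsets V w = {B. B \<subseteq> V \<and> card B = w}"
      using fin by (auto simp: nsets_def intro: finite_subset)
    then show ?thesis using n_subsets[OF fin, of w] by simp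
  qed
  have "w \<le> 4 * w ^ 2" by (simp add: power2_eq_square)
  also have "real (4 * w ^ 2) \<le> real (card V)" using large(1) unfolding w_def by simp
  then have "4 * w ^ 2 \<le> card V" by linarith
  finally have wn: "w \<le> card V" .
  then have chpos: "card V choose w > 0" by simp
  have finns: "finite (nsets V w)" "nsets V w \<noteq> {}"
    using card_gt_0_iff[of "nsets V w"] cardns chpos by simp_all
  have "nsets V w = (nsets V w \<inter> {S. Q S}) \<union> \<S>" by (auto simp: \<S>_def)
  then have "card (nsets V w) = card ((nsets V w \<inter> {S. Q S}) \<union> \<S>)" by simp
  also have "\<dots> = card (nsets V w \<inter> {S. Q S}) + card \<S>"
    by (rule card_Un_disjoint) (use finns sub in \<open>auto simp: \<S>_def\<close>)
  finally have "real (card (nsets V w \<inter> {S. Q S})) \<ge> 2 / 3 * real (card (nsets V w))"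
    using bad cardns by simp
  then show ?thesis
    using chpos unfolding w_def[symmetric] measure_pmf_of_set[OF finns(2,1)] cardns
    by (simp add: field_simps)
qed

section \<open>Robust breadth-first search\<close>

locale sym_graph =
  fixes V :: "'a set" and A :: "'a rel"
  assumes finite_V: "finite V" and A_sub: "A \<subseteq> V \<times> V" and sym_A: "sym A"
    and irrefl_A: "irrefl A"
begin

abbreviation N :: real where "N \<equiv> real (card V)"

text \<open>Closed walks are counted as vertex lists that merely contain one, so that walks of
  different lengths can be compared by padding the lists.\<close>

definition heavy :: "nat \<Rightarrow> real \<Rightarrow> 'a \<Rightarrow> bool" where
  "heavy r \<beta> v \<longleftrightarrow>
     \<beta> * N ^ (2 * r) \<le> real (card {ys \<in> lists_of V (2 * r). odd_closed A r (insert v (set ys))})"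

end

locale robust_bfs = sym_graph V A for V :: "'a set" and A +
  fixes U :: "'a set" and v :: 'a and \<gamma> :: real
  assumes U_sub: "U \<subseteq> V" and v_in: "v \<in> U" and \<gamma>_pos: "0 < \<gamma>" and \<gamma>_le: "\<gamma> \<le> 1"
begin

text \<open>The single root cannot in general supply \<open>\<gamma> * N\<close> neighbours, so the
  first layer is its whole neighbourhood in \<open>U\<close>. The later threshold provides many
  walks to every vertex reached and few edges to vertices left out.\<close>

primrec bfs :: "nat \<Rightarrow> 'a set \<times> 'a set" where
  "bfs 0 = ({v}, {v})"
| "bfs (Suc i) =
    (let B = fst (bfs i);
         L = {u \<in> U - B. (if i = 0 then 1 else \<gamma> * N) \<le> real (card {x \<in> snd (bfs i). (x, u) \<in> A})}
     in (B \<union> L, L))"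

definition ball :: "nat \<Rightarrow> 'a set" where "ball i = fst (bfs i)"
definition layer :: "nat \<Rightarrow> 'a set" where "layer i = snd (bfs i)"

lemma ball_0 [simp]: "ball 0 = {v}" and layer_0 [simp]: "layer 0 = {v}"
  by (simp_all add: ball_def layer_def)

lemma layer_Suc:
  "layer (Suc i) =
     {u \<in> U - ball i. (if i = 0 then 1 else \<gamma> * N) \<le> real (card {x \<in> layer i. (x, u) \<in> A})}"
  by (simp add: ball_def layer_def Let_def)

lemma ball_Suc: "ball (Suc i) = ball i \<union> layer (Suc i)"
  by (simp add: ball_def layer_def Let_def)

lemma ball_eq: "ball i = (\<Union>j\<le>i. layer j)"
  by (induction i) (auto simp: ball_Suc atMost_Suc)

lemma layer_sub: "layer i \<subseteq> U"
  using v_in by (cases i) (auto simp: layer_Suc)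

lemma ball_sub: "ball i \<subseteq> U"
  using layer_sub by (auto simp: ball_eq)

lemma finite_U: "finite U"
  using U_sub finite_V finite_subset by blast

lemma finite_layer [simp]: "finite (layer i)"
  using layer_sub finite_U finite_subset by blast

lemma finite_ball [simp]: "finite (ball i)"
  using ball_sub finite_U finite_subset by blast

lemma layer_disjoint:
  assumes "x \<in> layer i" "x \<in> layer j"
  shows "i = j"
proof -
  have False if "x \<in> layer i" "x \<in> layer j" "i < j" for i j
  proof (cases j)
    case (Suc k)
    with that have "x \<in> ball k" "x \<notin> ball k"
      by (auto simp: ball_eq layer_Suc)
    then show False by simp
  qed (use that in simp)
  with assms show ?thesis by (meson linorder_neqE_nat)
qed

lemma card_ball_Suc: "card (ball (Suc i)) = card (ball i) + card (layer (Suc i))"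
  unfolding ball_Suc by (rule card_Un_disjoint[OF finite_ball finite_layer]) (auto simp: layer_Suc)

lemma layer_1: "layer 1 = {u \<in> U. (v, u) \<in> A}"
proof -
  have "{x. x = v \<and> (x, u) \<in> A} = (if (v, u) \<in> A then {v} else {})" for u by auto
  moreover have "(v, v) \<notin> A" using irrefl_A by (auto simp: irrefl_def)
  ultimately show ?thesis unfolding One_nat_def layer_Suc by auto
qed

lemma few_neighbours_outside:
  assumes "u \<in> U - ball (Suc j)"
  shows "real (card {x \<in> layer j. (x, u) \<in> A}) \<le> \<gamma> * N"
proof -
  define k where "k = card {x \<in> layer j. (x, u) \<in> A}"
  have "\<not> (if j = 0 then 1 else \<gamma> * N) \<le> real k"
    using assms unfolding ball_Suc layer_Suc k_def by blast
  then have "real k \<le> \<gamma> * N"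
    using \<gamma>_pos by (cases "j = 0"; cases "k = 0") auto
  then show ?thesis by (simp only: k_def)
qed

section \<open>Growth of the balls\<close>

lemma N_pos: "N > 0"
  using finite_V U_sub v_in card_gt_0_iff by (metis empty_iff of_nat_0_less_iff subsetD)

text \<open>If all consecutive layers are joined by many potential edges, two consecutive layers have
  total size at least \<open>e N i\<close> by AM-GM, so that the ball grows quadratically.\<close>

lemma ball_growth:
  assumes e: "e > 0"
    and thick: "\<And>i. i < r \<Longrightarrow> e * N * real (card (ball i)) < real (card (layer i)) * real (card (layer (Suc i)))"
  shows "i \<le> r \<Longrightarrow> e * N * real i ^ 2 / 4 \<le> real (card (ball i))"
proof (induction i rule: induct_nat_012)
  case 0
  then show ?case by simp
next
  case 1
  then have "e * N < real (card (layer 1))" using thick[of 0] by simp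
  moreover have "e * N > 0" using e N_pos by simp
  ultimately show ?case using card_ball_Suc[of 0] by simp
next
  case (ge2 i)
  define a b where "a = real (card (layer (Suc i)))" and "b = real (card (layer (Suc (Suc i))))"
  have eN: "e * N > 0" using e N_pos by simp
  have "(e * N * real (Suc i)) ^ 2 = 4 * (e * N * (e * N * real (Suc i) ^ 2 / 4))"
    by (simp add: power2_eq_square)
  also have "\<dots> \<le> 4 * (e * N * real (card (ball (Suc i))))"
    using ge2 eN by (intro mult_left_mono) auto
  also have "\<dots> \<le> 4 * (a * b)"
    using thick[of "Suc i"] ge2.prems by (simp add: a_def b_def)
  also have "\<dots> \<le> (a + b) ^ 2"
    using zero_le_power2[of "a - b"] by (simp add: power2_eq_square algebra_simps)
  finally have "e * N * real (Suc i) \<le> a + b"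
    by (rule power2_le_imp_le) (simp add: a_def b_def)
  moreover have "real (card (ball (Suc (Suc i)))) = real (card (ball i)) + a + b"
    by (simp add: card_ball_Suc a_def b_def)
  moreover have "e * N * real i ^ 2 / 4 \<le> real (card (ball i))" using ge2 by simp
  ultimately have "e * N * real i ^ 2 / 4 + e * N * real (Suc i) \<le> real (card (ball (Suc (Suc i))))"
    by linarith
  \<comment> \<open>The identity \<open>i ^ 2 / 4 + (i + 1) = (i + 2) ^ 2 / 4\<close> is why the
    induction advances by two.\<close>
  then show ?case by (simp add: power2_eq_square field_simps)
qed

text \<open>Otherwise \<open>ball_growth\<close> would give the ball of radius \<open>r\<close> more
  than \<open>N\<close> vertices. Hence \<open>r\<close> of order \<open>1 / sqrt e\<close> layers
  suffice.\<close>

lemma thin_layer_exists: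
  assumes "e > 0" "e * real r ^ 2 > 4"
  shows "\<exists>i<r. real (card (layer i)) * real (card (layer (Suc i))) \<le> e * N * real (card (ball i))"
proof (rule ccontr)
  assume "\<not> ?thesis"
  then have "e * N * real r ^ 2 / 4 \<le> real (card (ball r))"
    by (intro ball_growth[OF assms(1), where r = r and i = r]) (auto simp: not_le)
  also have "\<dots> \<le> N"
    using ball_sub U_sub finite_V by (meson card_mono of_nat_mono order_trans)
  finally have "N * (e * real r ^ 2) \<le> N * 4" by (simp add: algebra_simps)
  with N_pos assms(2) show False by simp
qed

text \<open>The list has one entry for each of the \<open>i\<close> inner vertices of such a walk,
  but it only has to supply them, in any order; the ends are added separately. This fits the
  counting in \<open>heavy\<close>.\<close>

definition walks :: "'a \<Rightarrow> nat \<Rightarrow> 'a list set" where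
  "walks u i = {xs \<in> lists_of V i.
     (v, u) \<in> (A \<inter> insert v (insert u (set xs)) \<times> insert v (insert u (set xs))) ^^ Suc i}"

lemma finite_walks [simp]: "finite (walks u i)"
  unfolding walks_def using finite_V by simp

lemma walks_lists_of: "xs \<in> walks u i \<Longrightarrow> xs \<in> lists_of V i"
  unfolding walks_def by blast

lemma walks_relpow:
  assumes "xs \<in> walks u i" "insert v (insert u (set xs)) \<subseteq> S"
  shows "(v, u) \<in> (A \<inter> S \<times> S) ^^ Suc i"
proof -
  let ?T = "insert v (insert u (set xs))"
  have "(v, u) \<in> (A \<inter> ?T \<times> ?T) ^^ Suc i"
    using assms(1) unfolding walks_def by blast
  moreover have "A \<inter> ?T \<times> ?T \<subseteq> A \<inter> S \<times> S"
    using assms(2) by blast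
  ultimately show ?thesis
    using relpow_mono_rel by blast
qed

lemma walks_Cons:
  assumes "xs \<in> walks x i" "(x, u) \<in> A"
  shows "x # xs \<in> walks u (Suc i)"
proof -
  define S where "S = insert v (insert u (set (x # xs)))"
  have "(v, x) \<in> (A \<inter> S \<times> S) ^^ Suc i"
    by (rule walks_relpow[OF assms(1)]) (auto simp: S_def)
  moreover have "(x, u) \<in> A \<inter> S \<times> S"
    using assms by (auto simp: S_def)
  ultimately have "(v, u) \<in> (A \<inter> S \<times> S) ^^ Suc (Suc i)"
    by (rule relpow_Suc_I)
  moreover have "x # xs \<in> lists_of V (Suc i)"
    using walks_lists_of[OF assms(1)] assms(2) A_sub by (auto simp: lists_of_def)
  ultimately show ?thesis
    unfolding walks_def S_def by blast
qed

text \<open>Walking back from \<open>u\<close>, each of the \<open>i\<close> inner vertices can be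
  chosen in at least \<open>\<gamma> * N\<close> ways; the last step to the root is always
  available.\<close>

lemma many_walks: "u \<in> layer (Suc i) \<Longrightarrow> (\<gamma> * N) ^ i \<le> real (card (walks u i))"
proof (induction i arbitrary: u)
  case 0
  then have "(v, u) \<in> A" using layer_1 by simp
  then have "walks u 0 = {[]}"
    by (auto simp: walks_def lists_of_def)
  then show ?case by simp
next
  case (Suc i)
  define T where "T = {x \<in> layer (Suc i). (x, u) \<in> A}"
  have T: "\<gamma> * N \<le> real (card T)" "finite T"
    using Suc.prems by (auto simp: T_def layer_Suc[of "Suc i"])
  have "(\<lambda>(x, xs). x # xs) ` (SIGMA x:T. walks x i) \<subseteq> walks u (Suc i)"
    using walks_Cons by (auto simp: T_def)
  moreover have "inj_on (\<lambda>(x, xs). x # xs) (SIGMA x:T. walks x i)"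
    by (auto simp: inj_on_def)
  ultimately have "card (SIGMA x:T. walks x i) \<le> card (walks u (Suc i))"
    by (intro card_inj_on_le) auto
  moreover have "card (SIGMA x:T. walks x i) = (\<Sum>x\<in>T. card (walks x i))"
    using T by simp
  moreover have "(\<Sum>x\<in>T. (\<gamma> * N) ^ i) \<le> (\<Sum>x\<in>T. real (card (walks x i)))"
    by (rule sum_mono) (use Suc.IH in \<open>auto simp: T_def\<close>)
  ultimately have "real (card T) * (\<gamma> * N) ^ i \<le> real (card (walks u (Suc i)))"
    by (simp flip: of_nat_sum)
  moreover have "\<gamma> * N * (\<gamma> * N) ^ i \<le> real (card T) * (\<gamma> * N) ^ i"
    by (rule mult_right_mono) (use T \<gamma>_pos in auto)
  ultimately show ?case by simp
qed

text \<open>Both walks from the root have length \<open>i + 1\<close>, so the edge between their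
  ends closes them to the odd length \<open>2 * i + 3\<close>, at most
  \<open>2 * r + 1\<close>.\<close>

lemma walks_odd_closed:
  assumes "xs \<in> walks x i" "ys \<in> walks y i" "(x, y) \<in> A" "Suc i \<le> r"
    and "insert v (insert x (insert y (set xs \<union> set ys))) \<subseteq> S"
  shows "odd_closed A r S"
proof -
  let ?R = "A \<inter> S \<times> S"
  have "(v, x) \<in> ?R ^^ Suc i"
    by (rule walks_relpow[OF assms(1)]) (use assms(5) in auto)
  moreover have "(x, y) \<in> ?R ^^ 1" using assms by auto
  moreover have "(v, y) \<in> ?R ^^ Suc i"
    by (rule walks_relpow[OF assms(2)]) (use assms(5) in auto)
  then have "(y, v) \<in> ?R ^^ Suc i"
    by (rule symD[OF sym_relpow, rotated]) (use sym_A in \<open>auto simp: sym_def\<close>)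
  ultimately have "(v, v) \<in> ?R ^^ (Suc i + (1 + Suc i))"
    by (meson relpow_trans)
  then have "(v, v) \<in> ?R ^^ (2 * Suc i + 1)"
    by (simp add: mult_2)
  then show ?thesis
    by (rule odd_closed_lengthen[OF sym_A]) (rule assms(4))
qed

text \<open>Every pair inside a layer closes many pairs of walks from \<open>v\<close> into odd
  closed walks, so too many such pairs would make \<open>v\<close> heavy.\<close>

lemma few_edges_within_layer:
  assumes "\<not> heavy r (\<gamma> ^ (2 * r)) v" "i \<le> r"
  shows "real (card {(x, y) \<in> A. x \<in> layer i \<and> y \<in> layer i}) \<le> \<gamma> * N ^ 2"
proof (cases i)
  case 0
  then have empty: "{(x, y) \<in> A. x \<in> layer i \<and> y \<in> layer i} = {}"
    using irrefl_A by (auto simp: irrefl_def)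
  show ?thesis unfolding empty using \<gamma>_pos by simp
next
  case (Suc j)
  define I where "I = {(x, y) \<in> A. x \<in> layer i \<and> y \<in> layer i}"
  have finA: "finite A" using A_sub finite_V by (meson finite_SigmaI finite_subset)
  then have finI: "finite I" by (auto simp: I_def intro: finite_subset)
  \<comment> \<open>The third list pads \<open>x\<close>, \<open>y\<close> and two lists of length
    \<open>j\<close> to exactly \<open>2 * r\<close> entries; as the lengths are known,
    \<open>h\<close> can be decoded.\<close>
  define Z where "Z = (\<lambda>p. walks (fst p) j \<times> walks (snd p) j \<times> lists_of V (2 * r - 2 - 2 * j))"
  define h :: "('a \<times> 'a) \<times> 'a list \<times> 'a list \<times> 'a list \<Rightarrow> 'a list"
    where "h = (\<lambda>((x, y), (xs, ys, zs)). x # y # xs @ ys @ zs)"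
  define T where "T = {ys \<in> lists_of V (2 * r). odd_closed A r (insert v (set ys))}"
  have len: "length xs = n" if "xs \<in> walks x n" for xs x n
    using walks_lists_of[OF that] by (simp add: lists_of_def)
  have "inj_on h (Sigma I Z)"
  proof (rule inj_onI)
    fix p q
    assume *: "p \<in> Sigma I Z" "q \<in> Sigma I Z" "h p = h q"
    obtain x y xs ys zs where p: "p = ((x, y), xs, ys, zs)" by (metis surj_pair)
    obtain x' y' xs' ys' zs' where q: "q = ((x', y'), xs', ys', zs')" by (metis surj_pair)
    have "length xs = j" "length xs' = j" "length ys = j" "length ys' = j"
      using *(1,2) len unfolding p q Z_def by auto
    then show "p = q" using *(3) unfolding p q h_def by simp
  qed
  moreover have "h ` Sigma I Z \<subseteq> T"
  proof clarify
    fix x y xs ys zs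
    assume *: "(x, y) \<in> I" "(xs, ys, zs) \<in> Z (x, y)"
    let ?l = "x # y # xs @ ys @ zs"
    have w: "xs \<in> walks x j" "ys \<in> walks y j" "zs \<in> lists_of V (2 * r - 2 - 2 * j)" "(x, y) \<in> A"
      using * by (auto simp: Z_def I_def)
    then have "?l \<in> lists_of V (2 * r)"
      using A_sub Suc assms(2) by (auto simp: lists_of_def dest!: walks_lists_of)
    moreover have "odd_closed A r (insert v (set ?l))"
      by (rule walks_odd_closed[OF w(1,2,4)]) (use Suc assms(2) in auto)
    ultimately show "h ((x, y), (xs, ys, zs)) \<in> T"
      by (simp add: h_def T_def)
  qed
  moreover have "finite T" using finite_V by (simp add: T_def)
  ultimately have "card (Sigma I Z) \<le> card T"
    by (rule card_inj_on_le)
  moreover have "card (Sigma I Z) = (\<Sum>p\<in>I. card (Z p))"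
    using finI finite_V by (simp add: Z_def)
  ultimately have le_T: "(\<Sum>p\<in>I. real (card (Z p))) \<le> real (card T)"
    by (simp flip: of_nat_sum)
  have lower: "(\<gamma> * N) ^ j * ((\<gamma> * N) ^ j * N ^ (2 * r - 2 - 2 * j)) \<le> real (card (Z p))" if "p \<in> I" for p
  proof -
    have "fst p \<in> layer (Suc j)" "snd p \<in> layer (Suc j)"
      using that Suc by (auto simp: I_def)
    then show ?thesis
      unfolding Z_def using many_walks \<gamma>_pos
      by (simp add: card_cartesian_product card_lists_of[OF finite_V] mult_mono)
  qed
  have "(\<Sum>p\<in>I. (\<gamma> * N) ^ j * ((\<gamma> * N) ^ j * N ^ (2 * r - 2 - 2 * j))) \<le> (\<Sum>p\<in>I. real (card (Z p)))"
    by (rule sum_mono[OF lower])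
  also note le_T
  finally have le: "real (card I) * ((\<gamma> * N) ^ j * ((\<gamma> * N) ^ j * N ^ (2 * r - 2 - 2 * j))) \<le> real (card T)"
    by simp
  have "real (card I) \<le> \<gamma> * N ^ 2"
  proof (rule ccontr)
    assume neg: "\<not> ?thesis"
    have "N ^ (2 * r) = N ^ (2 + j + j + (2 * r - 2 - 2 * j))"
      using Suc assms(2) by (intro arg_cong[where f = "(^) N"]) simp
    then have split: "N ^ (2 * r) = N ^ 2 * N ^ j * N ^ j * N ^ (2 * r - 2 - 2 * j)"
      by (simp only: power_add)
    \<comment> \<open>One factor \<open>\<gamma>\<close> comes from the pairs in the layer and
      \<open>2 * j\<close> from the two walks; \<open>j < r\<close> keeps the exponent below
      \<open>2 * r\<close>.\<close>
    have "\<gamma> ^ (2 * r) * N ^ (2 * r) \<le> \<gamma> ^ (2 * j + 1) * N ^ (2 * r)"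
      by (intro mult_right_mono power_decreasing)
        (use \<gamma>_pos \<gamma>_le Suc assms(2) in auto)
    also have "\<gamma> ^ (2 * j + 1) * N ^ (2 * r) =
        (\<gamma> * N ^ 2) * ((\<gamma> * N) ^ j * ((\<gamma> * N) ^ j * N ^ (2 * r - 2 - 2 * j)))"
      unfolding split by (simp add: power_mult_distrib mult_2 power_add)
    also have "\<dots> \<le> real (card I) * ((\<gamma> * N) ^ j * ((\<gamma> * N) ^ j * N ^ (2 * r - 2 - 2 * j)))"
      by (rule mult_right_mono) (use neg \<gamma>_pos in auto)
    also note le
    finally show False
      using assms(1) by (simp add: heavy_def T_def)
  qed
  then show ?thesis by (simp add: I_def)
qed

text \<open>The search stops at a thin layer \<open>i\<close>, and the ball is coloured by the
  parity of the layer. Pairs leading beyond the next layer and pairs inside a layer number at most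
  \<open>e ^ 2 * N ^ 2\<close>, which is affordable since the ball has at least \<open>e * N\<close>
  vertices; the cut costs another \<open>e * N\<close> per vertex of the ball.\<close>

lemma bipartite_piece:
  assumes "\<not> heavy r (\<gamma> ^ (2 * r)) v"
    and e: "e > 0" and r: "e * real r ^ 2 > 4" and \<gamma>: "2 * real r * \<gamma> \<le> e ^ 2"
    and deg: "real (card {u \<in> U. (v, u) \<in> A}) > e * N"
  shows "\<exists>B D c. v \<in> B \<and> B \<subseteq> U \<and> D \<subseteq> V \<times> V \<and> real (card D) \<le> 2 * e * N * real (card B) \<and>
    (\<forall>x\<in>B. \<forall>y\<in>U. (x, y) \<in> A \<longrightarrow> (x, y) \<in> D \<or> (y, x) \<in> D \<or> (y \<in> B \<and> c x \<noteq> (c y :: bool)))"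
proof -
  obtain i where i: "i < r"
    "real (card (layer i)) * real (card (layer (Suc i))) \<le> e * N * real (card (ball i))"
    using thin_layer_exists[OF e r] by blast
  \<comment> \<open>A cut at the root would consist of the whole neighbourhood of \<open>v\<close>,
    which is larger than \<open>e * N\<close>. So the ball contains that neighbourhood.\<close>
  have "i \<noteq> 0"
  proof
    assume "i = 0"
    with i(2) have "real (card (layer 1)) \<le> e * N" by simp
    with deg layer_1 show False by simp
  qed
  then have "layer 1 \<subseteq> ball i" unfolding ball_eq by (intro UN_upper) simp
  then have "card (layer 1) \<le> card (ball i)" by (simp add: card_mono)
  with deg layer_1 have big: "e * N \<le> real (card (ball i))" by simp
  define D1 where "D1 = (\<Union>j\<le>i. {(x, y). x \<in> layer j \<and> y \<in> U - ball (Suc j) \<and> (x, y) \<in> A})"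
  define D2 where "D2 = (\<Union>j\<le>i. {(x, y) \<in> A. x \<in> layer j \<and> y \<in> layer j})"
  define D3 where "D3 = layer i \<times> layer (Suc i)"
  define c where "c = (\<lambda>x. \<exists>j. even j \<and> x \<in> layer j)"
  have c: "c x = even j" if "x \<in> layer j" for x j
    using that layer_disjoint unfolding c_def by blast
  have "card {(x, y). x \<in> layer j \<and> y \<in> U - ball (Suc j) \<and> (x, y) \<in> A} \<le> N * (\<gamma> * N)" for j
  proof -
    have "{(x, y). x \<in> layer j \<and> y \<in> U - ball (Suc j) \<and> (x, y) \<in> A} =
        prod.swap ` (SIGMA y:U - ball (Suc j). {x \<in> layer j. (x, y) \<in> A})"
      by auto
    also have "card \<dots> = card (SIGMA y:U - ball (Suc j). {x \<in> layer j. (x, y) \<in> A})"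
      by (rule card_image) simp
    also have "\<dots> = (\<Sum>y\<in>U - ball (Suc j). card {x \<in> layer j. (x, y) \<in> A})"
      using finite_U by simp
    also have "real \<dots> \<le> (\<Sum>y\<in>U - ball (Suc j). \<gamma> * N)"
      unfolding of_nat_sum by (rule sum_mono) (rule few_neighbours_outside)
    also have "\<dots> \<le> N * (\<gamma> * N)"
      unfolding sum_constant
      by (rule mult_right_mono) (use \<gamma>_pos U_sub finite_V in \<open>auto intro!: card_mono\<close>)
    finally show ?thesis .
  qed
  then have "(\<Sum>j\<le>i. real (card {(x, y). x \<in> layer j \<and> y \<in> U - ball (Suc j) \<and> (x, y) \<in> A}))
      \<le> (\<Sum>j\<le>i. N * (\<gamma> * N))"
    by (intro sum_mono)
  moreover have "card D1 \<le> (\<Sum>j\<le>i. card {(x, y). x \<in> layer j \<and> y \<in> U - ball (Suc j) \<and> (x, y) \<in> A})"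
    unfolding D1_def by (rule card_UN_le) simp
  ultimately have D1: "real (card D1) \<le> real (Suc i) * (N * (\<gamma> * N))"
    by (simp flip: of_nat_sum)
  have "(\<Sum>j\<le>i. real (card {(x, y) \<in> A. x \<in> layer j \<and> y \<in> layer j})) \<le> (\<Sum>j\<le>i. \<gamma> * N ^ 2)"
    by (intro sum_mono few_edges_within_layer[OF assms(1)]) (use i in auto)
  moreover have "card D2 \<le> (\<Sum>j\<le>i. card {(x, y) \<in> A. x \<in> layer j \<and> y \<in> layer j})"
    unfolding D2_def by (rule card_UN_le) simp
  ultimately have D2: "real (card D2) \<le> real (Suc i) * (\<gamma> * N ^ 2)"
    by (simp flip: of_nat_sum)
  have D3: "real (card D3) \<le> e * N * real (card (ball i))"
    using i(2) by (simp add: D3_def card_cartesian_product)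
  have "real (card (D1 \<union> D2 \<union> D3)) \<le> real (card D1 + card D2 + card D3)"
    by (meson add_le_mono1 card_Un_le of_nat_mono order_trans)
  also have "\<dots> \<le> real (Suc i) * (2 * \<gamma> * N ^ 2) + e * N * real (card (ball i))"
    using D1 D2 D3 by (simp add: power2_eq_square algebra_simps)
  also have "real (Suc i) * (2 * \<gamma> * N ^ 2) \<le> real r * (2 * \<gamma> * N ^ 2)"
    by (rule mult_right_mono) (use i \<gamma>_pos in auto)
  also have "\<dots> = 2 * real r * \<gamma> * N ^ 2" by simp
  also have "\<dots> \<le> e ^ 2 * N ^ 2"
    by (rule mult_right_mono[OF \<gamma>]) simp
  also have "\<dots> = e * N * (e * N)" by (simp add: power2_eq_square)
  also have "\<dots> \<le> e * N * real (card (ball i))"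
    by (rule mult_left_mono[OF big]) (use e in simp)
  finally have card_D: "real (card (D1 \<union> D2 \<union> D3)) \<le> 2 * e * N * real (card (ball i))"
    by simp
  have sub: "D1 \<union> D2 \<union> D3 \<subseteq> V \<times> V"
    using A_sub layer_sub U_sub by (fastforce simp: D1_def D2_def D3_def)
  have "(x, y) \<in> D1 \<union> D2 \<union> D3 \<or> (y, x) \<in> D1 \<union> D2 \<union> D3 \<or> (y \<in> ball i \<and> c x \<noteq> c y)"
    if xy: "x \<in> ball i" "y \<in> U" "(x, y) \<in> A" for x y
  proof -
    from xy obtain j where j: "j \<le> i" "x \<in> layer j" by (auto simp: ball_eq)
    have yx: "(y, x) \<in> A" using xy sym_A by (auto dest: symD)
    show ?thesis
    proof (cases "y \<in> ball (Suc j)")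
      case False
      then have "(x, y) \<in> D1" using xy j by (auto simp: D1_def)
      then show ?thesis by simp
    next
      case True
      then obtain k where k: "k \<le> Suc j" "y \<in> layer k" by (auto simp: ball_eq)
      consider "k = Suc j" "j = i" | "k = Suc j" "j < i" | "k = j" | "Suc k = j" | "Suc k < j"
        using k j by linarith
      then show ?thesis
      proof cases
        case 1
        then show ?thesis using j k by (simp add: D3_def)
      next
        case 2
        then have "y \<in> ball i" "c x \<noteq> c y" using j k c by (auto simp: ball_eq)
        then show ?thesis by simp
      next
        case 3
        then show ?thesis using j k xy by (auto simp: D2_def)
      next
        case 4
        then have "y \<in> ball i" "c x \<noteq> c y" using j k c by (auto simp: ball_eq)
        then show ?thesis by simp
      next
        case 5
        \<comment> \<open>An edge going back by more than one layer is, read from \<open>y\<close>,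
          an edge that skips a layer.\<close>
        have "x \<notin> ball (Suc k)"
        proof
          assume "x \<in> ball (Suc k)"
          then obtain l where "l \<le> Suc k" "x \<in> layer l" unfolding ball_eq by blast
          with 5 layer_disjoint[OF j(2)] show False by auto
        qed
        moreover have "x \<in> U" using j layer_sub by blast
        moreover have "k \<le> i" using 5 j by simp
        ultimately have "(y, x) \<in> D1" using k yx unfolding D1_def by blast
        then show ?thesis by simp
      qed
    qed
  qed
  moreover have "v \<in> ball i" by (force simp: ball_eq)
  ultimately show ?thesis
    using ball_sub sub card_D by blast
qed

end

section \<open>Peeling off pieces until the graph is exhausted\<close>

context sym_graph
begin

text \<open>Pieces are split off one at a time, each paying for all its edges to the remaining
  vertices, so the costs add up over a partition of \<open>U\<close>. A heavy root is isolated at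
  cost at most \<open>N\<close>, a root of low degree at cost at most \<open>e * N\<close>.\<close>

lemma near_bipartite_up_to_heavy:
  assumes e: "e > 0" and r: "e * real r ^ 2 > 4" and \<gamma>: "2 * real r * \<gamma> \<le> e ^ 2" "0 < \<gamma>" "\<gamma> \<le> 1"
    and "U \<subseteq> V"
  shows "\<exists>D c. D \<subseteq> V \<times> V \<and>
    real (card D) \<le> 2 * e * N * real (card U) + N * real (card {v \<in> U. heavy r (\<gamma> ^ (2 * r)) v}) \<and>
    (\<forall>x\<in>U. \<forall>y\<in>U. (x, y) \<in> A \<longrightarrow> (x, y) \<in> D \<or> (y, x) \<in> D \<or> c x \<noteq> (c y :: bool))"
  using \<open>U \<subseteq> V\<close>
proof (induction "card U" arbitrary: U rule: less_induct)
  case less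
  let ?H = "\<lambda>v. heavy r (\<gamma> ^ (2 * r)) v"
  have finU: "finite U" using less.prems finite_V finite_subset by blast
  show ?case
  proof (cases "U = {}")
    case True
    then show ?thesis using e by (intro exI[of _ "{}"]) auto
  next
    case False
    then obtain v where v: "v \<in> U" by blast
    have "\<exists>B D c. v \<in> B \<and> B \<subseteq> U \<and> D \<subseteq> V \<times> V \<and>
      real (card D) \<le> 2 * e * N * real (card B) + N * real (card {v \<in> B. ?H v}) \<and>
      (\<forall>x\<in>B. \<forall>y\<in>U. (x, y) \<in> A \<longrightarrow> (x, y) \<in> D \<or> (y, x) \<in> D \<or> (y \<in> B \<and> c x \<noteq> (c y :: bool)))"
    proof (cases "?H v \<or> real (card {u \<in> U. (v, u) \<in> A}) \<le> e * N")
      case True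
      define D where "D = {v} \<times> {u \<in> U. (v, u) \<in> A}"
      have card_D: "card D = card {u \<in> U. (v, u) \<in> A}"
        by (simp add: D_def card_cartesian_product)
      also have "\<dots> \<le> card V"
        using finite_V less.prems by (auto intro: card_mono)
      finally have le: "real (card D) \<le> N" by simp
      have eN: "e * N \<ge> 0" using e by simp
      have "real (card D) \<le> 2 * e * N * real (card {v}) + N * real (card {v' \<in> {v}. ?H v'})"
      proof (cases "?H v")
        case True
        then have "{v' \<in> {v}. ?H v'} = {v}" by auto
        then show ?thesis using le eN by simp
      next
        case False
        with \<open>?H v \<or> _\<close> card_D have "real (card D) \<le> e * N" by simp
        moreover have "0 \<le> N * real (card {v' \<in> {v}. ?H v'})" by simp
        moreover have "2 * e * N * real (card {v}) = 2 * (e * N)" by simp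
        ultimately show ?thesis using eN by linarith
      qed
      then show ?thesis
        using v less.prems by (intro exI[of _ "{v}"] exI[of _ D]) (auto simp: D_def)
    next
      case False
      interpret robust_bfs V A U v \<gamma>
        by unfold_locales (use v less.prems \<gamma> in auto)
      obtain B D c where
        BD: "v \<in> B" "B \<subseteq> U" "D \<subseteq> V \<times> V" "real (card D) \<le> 2 * e * N * real (card B)"
        "\<forall>x\<in>B. \<forall>y\<in>U. (x, y) \<in> A \<longrightarrow> (x, y) \<in> D \<or> (y, x) \<in> D \<or> (y \<in> B \<and> c x \<noteq> (c y :: bool))"
        using bipartite_piece[of r e] False e r \<gamma>(1) by auto
      moreover have "0 \<le> N * real (card {v \<in> B. ?H v})" by simp
      then have "real (card D) \<le> 2 * e * N * real (card B) + N * real (card {v \<in> B. ?H v})"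
        using BD(4) by linarith
      ultimately show ?thesis
        by blast
    qed
    then obtain B D c where
      BD: "v \<in> B" "B \<subseteq> U" "D \<subseteq> V \<times> V"
      "real (card D) \<le> 2 * e * N * real (card B) + N * real (card {v \<in> B. ?H v})"
      "\<And>x y. x \<in> B \<Longrightarrow> y \<in> U \<Longrightarrow> (x, y) \<in> A \<Longrightarrow>
         (x, y) \<in> D \<or> (y, x) \<in> D \<or> (y \<in> B \<and> c x \<noteq> (c y :: bool))"
      by blast
    have finB: "finite B" using BD finU finite_subset by blast
    have "card (U - B) < card U"
      using BD finU v by (intro psubset_card_mono) auto
    from less.hyps[OF this] less.prems obtain D' c' where
      D': "D' \<subseteq> V \<times> V"
      "real (card D') \<le> 2 * e * N * real (card (U - B)) + N * real (card {v \<in> U - B. ?H v})"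
      "\<And>x y. x \<in> U - B \<Longrightarrow> y \<in> U - B \<Longrightarrow> (x, y) \<in> A \<Longrightarrow>
         (x, y) \<in> D' \<or> (y, x) \<in> D' \<or> c' x \<noteq> (c' y :: bool)"
      by blast
    have "card U = card (B \<union> (U - B))"
      using BD by (intro arg_cong[where f = card]) auto
    also have "\<dots> = card B + card (U - B)"
      using finB finU by (intro card_Un_disjoint) auto
    finally have c1: "card U = card B + card (U - B)" .
    have "card {v \<in> U. ?H v} = card ({v \<in> B. ?H v} \<union> {v \<in> U - B. ?H v})"
      using BD by (intro arg_cong[where f = card]) auto
    also have "\<dots> = card {v \<in> B. ?H v} + card {v \<in> U - B. ?H v}"
      using finB finU by (intro card_Un_disjoint) auto
    finally have c2: "card {v \<in> U. ?H v} = card {v \<in> B. ?H v} + card {v \<in> U - B. ?H v}" .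
    have "real (card (D \<union> D')) \<le> real (card D) + real (card D')"
      by (metis card_Un_le of_nat_add of_nat_mono)
    then have "real (card (D \<union> D')) \<le> 2 * e * N * real (card U) + N * real (card {v \<in> U. ?H v})"
      using BD(4) D'(2) unfolding c1 c2 by (simp add: algebra_simps)
    \<comment> \<open>All edges leaving \<open>B\<close> are covered by \<open>D\<close>, so the two
      colourings can be combined without any compatibility.\<close>
    moreover have "(x, y) \<in> D \<union> D' \<or> (y, x) \<in> D \<union> D' \<or>
        (if x \<in> B then c x else c' x) \<noteq> (if y \<in> B then c y else c' y)"
      if "x \<in> U" "y \<in> U" "(x, y) \<in> A" for x y
    proof (cases "x \<in> B")
      case True
      then show ?thesis using BD(5)[OF True that(2,3)] by auto
    next
      case x: False
      show ?thesis
      proof (cases "y \<in> B")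
        case True
        have "(y, x) \<in> A" using that sym_A by (auto dest: symD)
        then show ?thesis using BD(5)[OF True that(1)] x by auto
      next
        case False
        then show ?thesis using D'(3)[of x y] x that by auto
      qed
    qed
    ultimately show ?thesis
      using BD(3) D'(1)
      by (intro exI[of _ "D \<union> D'"] exI[of _ "\<lambda>x. if x \<in> B then c x else c' x"]) auto
  qed
qed

text \<open>If at most \<open>e * N\<close> roots are heavy, they add only \<open>e * N ^ 2\<close>
  to the deletions. Otherwise prefixing each heavy root to its lists produces enough lists of length
  \<open>2 * r + 1\<close>.\<close>

lemma many_odd_closed_or_near_bipartite:
  assumes e: "e > 0" and r: "e * real r ^ 2 > 4" and \<gamma>: "2 * real r * \<gamma> \<le> e ^ 2" "0 < \<gamma>" "\<gamma> \<le> 1"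
  shows "e * \<gamma> ^ (2 * r) * N ^ (2 * r + 1) \<le> real (card {xs \<in> lists_of V (2 * r + 1). odd_closed A r (set xs)}) \<or>
    (\<exists>D c. D \<subseteq> V \<times> V \<and> real (card D) \<le> 3 * e * N ^ 2 \<and>
      (\<forall>(x, y) \<in> A. (x, y) \<in> D \<or> (y, x) \<in> D \<or> c x \<noteq> (c y :: bool)))"
proof -
  define H where "H = {v \<in> V. heavy r (\<gamma> ^ (2 * r)) v}"
  have finH: "finite H" using finite_V by (simp add: H_def)
  show ?thesis
  proof (cases "real (card H) \<le> e * N")
    case True
    obtain D c where D: "D \<subseteq> V \<times> V" "real (card D) \<le> 2 * e * N * N + N * real (card H)"
      "\<forall>x\<in>V. \<forall>y\<in>V. (x, y) \<in> A \<longrightarrow> (x, y) \<in> D \<or> (y, x) \<in> D \<or> c x \<noteq> (c y :: bool)"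
      using near_bipartite_up_to_heavy[OF e r \<gamma> subset_refl] unfolding H_def by blast
    have "N * real (card H) \<le> N * (e * N)"
      by (rule mult_left_mono[OF True]) simp
    with D(2) have "real (card D) \<le> 3 * e * N ^ 2"
      by (simp add: power2_eq_square algebra_simps)
    moreover have "\<forall>(x, y) \<in> A. (x, y) \<in> D \<or> (y, x) \<in> D \<or> c x \<noteq> c y"
      using D(3) A_sub by blast
    ultimately show ?thesis using D(1) by blast
  next
    case False
    define Y where "Y v = {ys \<in> lists_of V (2 * r). odd_closed A r (insert v (set ys))}" for v
    define T where "T = {xs \<in> lists_of V (2 * r + 1). odd_closed A r (set xs)}"
    have "(\<lambda>(x, xs). x # xs) ` (SIGMA x:H. Y x) \<subseteq> T"
      by (auto simp: T_def Y_def H_def lists_of_def)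
    moreover have "inj_on (\<lambda>(x, xs). x # xs) (SIGMA x:H. Y x)"
      by (auto simp: inj_on_def)
    moreover have "finite T" using finite_V by (simp add: T_def)
    ultimately have "card (SIGMA x:H. Y x) \<le> card T"
      by (intro card_inj_on_le)
    then have "(\<Sum>x\<in>H. card (Y x)) \<le> card T"
      using finH finite_V by (simp add: Y_def)
    then have "(\<Sum>x\<in>H. real (card (Y x))) \<le> real (card T)"
      by (simp flip: of_nat_sum)
    moreover have "(\<Sum>x\<in>H. \<gamma> ^ (2 * r) * N ^ (2 * r)) \<le> (\<Sum>x\<in>H. real (card (Y x)))"
      by (rule sum_mono) (auto simp: H_def Y_def heavy_def)
    ultimately have "real (card H) * (\<gamma> ^ (2 * r) * N ^ (2 * r)) \<le> real (card T)"
      by simp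
    moreover have "e * N * (\<gamma> ^ (2 * r) * N ^ (2 * r)) \<le> real (card H) * (\<gamma> ^ (2 * r) * N ^ (2 * r))"
      by (rule mult_right_mono) (use False \<gamma> in auto)
    ultimately show ?thesis by (simp add: T_def mult_ac)
  qed
qed

end

section \<open>The property and its upper bound\<close>

definition adj :: "graph \<Rightarrow> nat rel" where
  "adj G = {(u, v). {u, v} \<in> edges G}"

text \<open>Deleting vertices shrinks the set of forbidden lengths, so the dependence on the order
  respects monotonicity. The case \<open>k = 0\<close> excludes only loops, which simple graphs do
  not have.\<close>

definition no_short_odd_cycle :: "graph set" where
  "no_short_odd_cycle = {G. simple_graph G \<and>
     (\<forall>k x. 2 ^ (k ^ 2) \<le> card (verts G) \<longrightarrow> (x, x) \<notin> adj G ^^ (2 * k + 1))}"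

lemma sym_graph_adj:
  assumes "simple_graph G"
  shows "sym_graph (verts G) (adj G)"
proof
  show "finite (verts G)" using assms by (simp add: simple_graph_def)
  have "u \<in> verts G \<and> v \<in> verts G \<and> u \<noteq> v" if "(u, v) \<in> adj G" for u v
  proof -
    have "{u, v} \<in> nsets (verts G) 2"
      using that assms unfolding adj_def simple_graph_def by blast
    then show ?thesis by simp
  qed
  then show "adj G \<subseteq> verts G \<times> verts G" "irrefl (adj G)"
    by (auto simp: irrefl_def)
  show "sym (adj G)" by (auto simp: adj_def sym_def insert_commute)
qed

lemma relpow_map:
  fixes R :: "'a rel"
  assumes "\<And>x y. (x, y) \<in> R \<Longrightarrow> (g x, g y) \<in> S"
  shows "(x, y) \<in> R ^^ n \<Longrightarrow> (g x, g y) \<in> S ^^ n"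
proof (induction n arbitrary: y)
  case (Suc n)
  then show ?case using assms by (meson relpow_Suc_E relpow_Suc_I)
qed simp

lemma no_short_odd_cycle_subgraph:
  assumes G: "G \<in> no_short_odd_cycle" and H: "simple_graph H"
    and sub: "verts H \<subseteq> verts G" "edges H \<subseteq> edges G"
  shows "H \<in> no_short_odd_cycle"
proof -
  have "adj H \<subseteq> adj G" using sub by (auto simp: adj_def)
  then have "adj H ^^ n \<subseteq> adj G ^^ n" for n by (rule relpow_mono_rel)
  moreover have "card (verts H) \<le> card (verts G)"
    using G sub by (intro card_mono) (auto simp: no_short_odd_cycle_def simple_graph_def)
  ultimately show ?thesis
    using G H unfolding no_short_odd_cycle_def by (blast intro: order_trans)
qed

lemma monotone_no_short_odd_cycle: "monotone_graph_property no_short_odd_cycle"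
proof -
  have iso: "H \<in> no_short_odd_cycle"
    if G: "G \<in> no_short_odd_cycle" and H: "simple_graph H" "isomorphic G H" for G H
  proof -
    obtain f where f: "bij_betw f (verts G) (verts H)" "edges H = (\<lambda>e. f ` e) ` edges G"
      using H by (auto simp: isomorphic_def)
    define g where "g = inv_into (verts G) f"
    have "(g u, g v) \<in> adj G" if "(u, v) \<in> adj H" for u v
    proof -
      from that f obtain e where e: "e \<in> edges G" "{u, v} = f ` e"
        by (auto simp: adj_def)
      have "e \<subseteq> verts G"
        using G e by (auto simp: no_short_odd_cycle_def simple_graph_def nsets_def)
      then have "g ` f ` e = e"
        unfolding g_def using f(1) by (intro inv_into_image_cancel) (auto simp: bij_betw_def)
      with e show ?thesis by (simp add: adj_def flip: e(2))
    qed
    then have "(g x, g x) \<in> adj G ^^ n" if "(x, x) \<in> adj H ^^ n" for x n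
      using relpow_map that by metis
    moreover have "card (verts H) = card (verts G)"
      using bij_betw_same_card[OF f(1)] by simp
    ultimately show ?thesis
      using G H(1) by (auto simp: no_short_odd_cycle_def simp del: relpow.simps)
  qed
  have "remove_verts G W \<in> no_short_odd_cycle" if "G \<in> no_short_odd_cycle" for G W
  proof -
    have "simple_graph (remove_verts G W)"
      using that by (fastforce simp: no_short_odd_cycle_def simple_graph_def remove_verts_def nsets_def)
    then show ?thesis
      by (rule no_short_odd_cycle_subgraph[OF that]) (auto simp: remove_verts_def)
  qed
  moreover have "remove_edges G F \<in> no_short_odd_cycle" if "G \<in> no_short_odd_cycle" for G F
  proof -
    have "simple_graph (remove_edges G F)"
      using that by (auto simp: no_short_odd_cycle_def simple_graph_def remove_edges_def)
    then show ?thesis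
      by (rule no_short_odd_cycle_subgraph[OF that]) (auto simp: remove_edges_def)
  qed
  moreover have "\<forall>G\<in>no_short_odd_cycle. simple_graph G"
    by (simp add: no_short_odd_cycle_def)
  ultimately show ?thesis
    using iso unfolding monotone_graph_property_def graph_property_def by blast
qed

section \<open>From farness to a sufficient sample size\<close>

lemma adj_induced_subgraph: "adj (induced_subgraph G S) = adj G \<inter> S \<times> S"
  by (auto simp: adj_def induced_subgraph_def)

lemma simple_induced_subgraph:
  assumes "simple_graph G" "S \<subseteq> verts G"
  shows "simple_graph (induced_subgraph G S)"
  using assms by (auto simp: simple_graph_def induced_subgraph_def nsets_def intro: finite_subset)

lemma odd_closed_induced_subgraph:
  assumes "odd_closed (adj G) r S" "2 ^ (r ^ 2) \<le> card S"
  shows "induced_subgraph G S \<notin> no_short_odd_cycle"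
proof -
  obtain x where "(x, x) \<in> (adj G \<inter> S \<times> S) ^^ (2 * r + 1)"
    using assms(1) unfolding odd_closed_def by blast
  then have "(x, x) \<in> adj (induced_subgraph G S) ^^ (2 * r + 1)"
    by (simp only: adj_induced_subgraph)
  moreover have "2 ^ (r ^ 2) \<le> card (verts (induced_subgraph G S))"
    using assms(2) by (simp add: induced_subgraph_def)
  ultimately show ?thesis unfolding no_short_odd_cycle_def by blast
qed

text \<open>Deleting the edges met by \<open>D\<close> leaves a properly 2-coloured graph, which has
  the property whatever its order. One pair, in either orientation, accounts for an edge.\<close>

lemma far_not_near_bipartite:
  assumes G: "simple_graph G" and far: "far_from \<epsilon> no_short_odd_cycle G"
    and D: "D \<subseteq> verts G \<times> verts G"
      "\<And>x y. (x, y) \<in> adj G \<Longrightarrow> (x, y) \<in> D \<or> (y, x) \<in> D \<or> c x \<noteq> (c y :: bool)"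
  shows "\<epsilon> * (real (card (verts G)))\<^sup>2 \<le> real (card D)"
proof -
  define F where "F = {e \<in> edges G. \<exists>(x, y) \<in> D. e = {x, y}}"
  have "finite D"
    using D(1) G by (meson finite_SigmaI finite_subset simple_graph_def)
  moreover have "F \<subseteq> (\<lambda>(x, y). {x, y}) ` D"
    by (auto simp: F_def)
  ultimately have "card F \<le> card D"
    by (meson card_image_le card_mono finite_imageI order_trans)
  moreover have "remove_edges G F \<in> no_short_odd_cycle"
  proof -
    have "c x \<noteq> c y" if "(x, y) \<in> adj (remove_edges G F)" for x y
      using that D(2)[of x y] by (auto simp: adj_def remove_edges_def F_def insert_commute)
    then have "(x, x) \<notin> adj (remove_edges G F) ^^ (2 * k + 1)" for x k
      by (rule two_coloured_no_odd_closed_walk)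
    moreover have "simple_graph (remove_edges G F)"
      using G by (auto simp: simple_graph_def remove_edges_def)
    ultimately show ?thesis unfolding no_short_odd_cycle_def by blast
  qed
  moreover have "F \<subseteq> edges G" by (auto simp: F_def)
  ultimately show ?thesis
    using far unfolding far_from_def by (meson of_nat_mono order_trans)
qed

text \<open>The dichotomy is applied with \<open>e = \<epsilon> / 4\<close>: its second alternative
  deletes at most \<open>3 / 4 * \<epsilon> * N ^ 2\<close> edges, too few for a far graph. The
  condition \<open>2 ^ (r ^ 2) \<le> q\<close> makes the length \<open>2 * r + 1\<close> forbidden
  in the sample.\<close>

lemma sample_size_sufficesI:
  assumes \<epsilon>: "\<epsilon> > 0" and r: "\<epsilon> * real r ^ 2 > 16" and \<gamma>: "2 * real r * \<gamma> \<le> (\<epsilon> / 4) ^ 2" "0 < \<gamma>" "\<gamma> \<le> 1"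
    and q: "2 / (\<epsilon> / 4 * \<gamma> ^ (2 * r)) \<le> real q" "2 ^ (r ^ 2) \<le> q"
  shows "sample_size_suffices no_short_odd_cycle \<epsilon> (q * (2 * r + 1))"
  unfolding sample_size_suffices_def
proof (intro exI[of _ "4 * (q * (2 * r + 1)) ^ 2 + 1"] allI impI)
  fix G
  let ?w = "q * (2 * r + 1)" and ?V = "verts G"
  assume *: "simple_graph G \<and> 4 * ?w\<^sup>2 + 1 \<le> card ?V \<and> far_from \<epsilon> no_short_odd_cycle G"
  then have G: "simple_graph G" and far: "far_from \<epsilon> no_short_odd_cycle G"
    and card: "4 * ?w\<^sup>2 + 1 \<le> card ?V" by auto
  interpret sym_graph ?V "adj G" using G by (rule sym_graph_adj)
  have pos: "card ?V > 0" using card by simp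
  have "real (4 * ?w\<^sup>2 + 1) \<le> real (card ?V)" using card by (rule of_nat_mono)
  then have card': "real (card ?V) \<ge> 4 * real ?w ^ 2" by simp
  have "\<not> (\<exists>D c. D \<subseteq> ?V \<times> ?V \<and> real (card D) \<le> 3 * (\<epsilon> / 4) * N ^ 2 \<and>
      (\<forall>(x, y) \<in> adj G. (x, y) \<in> D \<or> (y, x) \<in> D \<or> c x \<noteq> (c y :: bool)))"
  proof clarify
    fix D c
    assume D: "D \<subseteq> ?V \<times> ?V" "real (card D) \<le> 3 * (\<epsilon> / 4) * N ^ 2"
      "\<forall>(x, y) \<in> adj G. (x, y) \<in> D \<or> (y, x) \<in> D \<or> c x \<noteq> (c y :: bool)"
    have "\<epsilon> * N ^ 2 \<le> real (card D)"
      by (rule far_not_near_bipartite[OF G far D(1), of c]) (use D(3) in blast)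
    also note D(2)
    finally show False using \<epsilon> pos by simp
  qed
  moreover have "\<epsilon> / 4 > 0" "\<epsilon> / 4 * real r ^ 2 > 4" using \<epsilon> r by auto
  ultimately have hits: "\<epsilon> / 4 * \<gamma> ^ (2 * r) * N ^ (2 * r + 1)
      \<le> real (card {xs \<in> lists_of ?V (2 * r + 1). odd_closed (adj G) r (set xs)})"
    using many_odd_closed_or_near_bipartite[of "\<epsilon> / 4" r \<gamma>] \<gamma> by blast
  have "2 / 3 \<le> measure_pmf.prob (pmf_of_set (nsets ?V ?w)) {S. odd_closed (adj G) r S}"
    by (rule prob_subset_hits[OF finite_V odd_closed_mono hits _ q(1) card' pos])
      (use \<epsilon> \<gamma>(2) in auto)
  \<comment> \<open>On the support the sets have exactly \<open>?w\<close> elements, so their size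
    reaches \<open>2 ^ (r ^ 2)\<close>.\<close>
  also have "\<dots> = measure_pmf.prob (pmf_of_set (nsets ?V ?w))
      ({S. odd_closed (adj G) r S} \<inter> set_pmf (pmf_of_set (nsets ?V ?w)))"
    by (simp add: measure_Int_set_pmf)
  also have "\<dots> \<le> measure_pmf.prob (pmf_of_set (nsets ?V ?w)) {S. induced_subgraph G S \<notin> no_short_odd_cycle}"
  proof (rule measure_pmf.finite_measure_mono)
    have "?w \<le> 4 * ?w\<^sup>2" by (simp add: power2_eq_square)
    then have "?w \<le> card ?V" using card by linarith
    then have "set_pmf (pmf_of_set (nsets ?V ?w)) = nsets ?V ?w"
      using finite_V by (intro set_pmf_of_set) (auto simp: nsets_eq_empty_iff finite_imp_finite_nsets)
    moreover have "2 ^ (r ^ 2) \<le> ?w" using q(2) by (simp add: trans_le_add1)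
    ultimately show "{S. odd_closed (adj G) r S} \<inter> set_pmf (pmf_of_set (nsets ?V ?w))
        \<subseteq> {S. induced_subgraph G S \<notin> no_short_odd_cycle}"
      using odd_closed_induced_subgraph[of G r] by (auto simp: nsets_def)
  qed simp
  finally show "2 / 3 \<le> measure_pmf.prob (pmf_of_set (nsets ?V ?w)) {S. induced_subgraph G S \<notin> no_short_odd_cycle}" .
qed

text \<open>With \<open>r\<close> of order \<open>1 / sqrt \<epsilon>\<close> all factors of
  \<open>w\<close> are at most \<open>2\<close> to a multiple of \<open>r ^ 2\<close>, in total
  \<open>18 * r ^ 2\<close>; then \<open>r ^ 2 \<le> 36 / \<epsilon>\<close> gives
  \<open>648 = 18 * 36\<close>.\<close>

lemma sample_size_upper:
  assumes "0 < \<epsilon>" "\<epsilon> < 1"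
  shows "\<exists>w>0. sample_size_suffices no_short_odd_cycle \<epsilon> w \<and> log 2 (real w) \<le> 648 / \<epsilon>"
proof -
  define s where "s = 1 / sqrt \<epsilon>"
  have s1: "s > 1" using assms by (simp add: s_def)
  have s2: "s ^ 2 = 1 / \<epsilon>" using assms by (simp add: s_def power_divide)
  \<comment> \<open>The summand \<open>1\<close> makes \<open>r\<close> exceed \<open>4 * s\<close>
    strictly, and \<open>s > 1\<close> absorbs the rounding into \<open>6 * s\<close>.\<close>
  define r where "r = nat \<lceil>4 * s\<rceil> + 1"
  have r_lower: "4 * s < real r" and r_upper: "real r \<le> 6 * s"
    unfolding r_def using s1 by linarith+
  have "(4 * s) ^ 2 < real r ^ 2"
    by (rule power_strict_mono) (use r_lower s1 in auto)
  then have "16 * (1 / \<epsilon>) < real r ^ 2" by (simp add: power_mult_distrib s2)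
  then have r16: "\<epsilon> * real r ^ 2 > 16" using assms by (simp add: field_simps)
  have "real r ^ 2 \<le> (6 * s) ^ 2"
    by (rule power_mono) (use r_upper in auto)
  then have r36: "real r ^ 2 \<le> 36 / \<epsilon>" by (simp add: power_mult_distrib s2)
  have r4: "r \<ge> 4" using r_lower s1 by linarith
  define \<gamma> where "\<gamma> = (\<epsilon> / 4) ^ 2 / (2 * real r)"
  have \<gamma>: "2 * real r * \<gamma> \<le> (\<epsilon> / 4) ^ 2" "0 < \<gamma>"
    using assms r4 by (auto simp: \<gamma>_def)
  have "(\<epsilon> / 4) ^ 2 \<le> 1" using assms by (intro power_le_one) auto
  then have \<gamma>1: "\<gamma> \<le> 1" unfolding \<gamma>_def using r4 by (simp add: divide_le_eq)
  define \<delta> where "\<delta> = \<epsilon> / 4 * \<gamma> ^ (2 * r)"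
  define q where "q = nat \<lceil>2 / \<delta>\<rceil> + 2 ^ (r ^ 2)"
  define w where "w = q * (2 * r + 1)"
  have \<delta>_pos: "\<delta> > 0" using assms \<gamma> by (simp add: \<delta>_def)
  have q_lower: "2 / \<delta> \<le> real q" "2 ^ (r ^ 2) \<le> q"
    unfolding q_def by (auto intro: order_trans[OF real_nat_ceiling_ge])
  have suff: "sample_size_suffices no_short_odd_cycle \<epsilon> w"
    unfolding w_def
    by (rule sample_size_sufficesI[OF assms(1) r16 \<gamma> \<gamma>1]) (use q_lower in \<open>auto simp: \<delta>_def\<close>)
  have r2r: "real r \<le> 2 ^ r" by (metis less_exp less_imp_le of_nat_le_iff of_nat_numeral of_nat_power)
  have rsq: "r \<le> r ^ 2" by (simp add: power2_eq_square)
  have inv\<epsilon>: "4 / \<epsilon> \<le> real r ^ 2" using r16 assms by (simp add: field_simps)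
  \<comment> \<open>A polynomial bound in \<open>r\<close> is weakened by
    \<open>r \<le> 2 ^ r\<close>. This is harmless: the power \<open>2 * r\<close> of
    \<open>2 ^ (6 * r)\<close> still has exponent of order \<open>r ^ 2\<close>.\<close>
  have "1 / \<gamma> = 2 * real r * (4 / \<epsilon>) ^ 2"
    using assms r4 by (simp add: \<gamma>_def field_simps power2_eq_square)
  also have "\<dots> \<le> 2 * real r * (real r ^ 2) ^ 2"
    by (intro mult_left_mono power_mono) (use inv\<epsilon> assms in auto)
  also have "\<dots> = 2 * real r ^ 5" by (simp flip: power_mult add: power_numeral_reduce)
  also have "\<dots> \<le> 2 ^ r * (2 ^ r) ^ 5"
  proof (rule mult_mono)
    have "(2::real) ^ 1 \<le> 2 ^ r" using r4 by (intro power_increasing) auto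
    then show "(2::real) \<le> 2 ^ r" by simp
  qed (use r2r in \<open>auto intro: power_mono\<close>)
  also have "\<dots> = 2 ^ (6 * r)" by (simp flip: power_mult power_add)
  finally have inv\<gamma>: "1 / \<gamma> \<le> 2 ^ (6 * r)" .
  have "1 / \<delta> = 4 / \<epsilon> * (1 / \<gamma>) ^ (2 * r)"
    by (simp add: \<delta>_def power_divide)
  also have "\<dots> \<le> (2 ^ r) ^ 2 * (2 ^ (6 * r)) ^ (2 * r)"
  proof (rule mult_mono)
    have "real r ^ 2 \<le> (2 ^ r) ^ 2" by (rule power_mono[OF r2r]) simp
    with inv\<epsilon> show "4 / \<epsilon> \<le> (2 ^ r) ^ 2" by linarith
    show "(1 / \<gamma>) ^ (2 * r) \<le> (2 ^ (6 * r)) ^ (2 * r)"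
      by (rule power_mono[OF inv\<gamma>]) (use \<gamma> in simp)
  qed (use \<gamma> in auto)
  also have "\<dots> = 2 ^ (2 * r + 12 * r ^ 2)"
    by (simp add: power2_eq_square mult_ac flip: power_mult power_add)
  also have "\<dots> \<le> 2 ^ (14 * r ^ 2)"
    by (rule power_increasing) (use rsq in auto)
  finally have inv\<delta>: "1 / \<delta> \<le> 2 ^ (14 * r ^ 2)" .
  have "real q \<le> 2 / \<delta> + 1 + 2 ^ (r ^ 2)"
    using \<delta>_pos ceiling_correct[of "2 / \<delta>"] by (simp add: q_def)
  also have "\<dots> \<le> 2 * 2 ^ (14 * r ^ 2) + 2 ^ (14 * r ^ 2) + 2 ^ (14 * r ^ 2)"
  proof (intro add_mono)
    show "2 / \<delta> \<le> 2 * 2 ^ (14 * r ^ 2)" using inv\<delta> by simp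
    show "(2::real) ^ (r ^ 2) \<le> 2 ^ (14 * r ^ 2)" by (rule power_increasing) auto
  qed simp
  also have "\<dots> = 2 ^ (14 * r ^ 2 + 2)" by simp
  also have "\<dots> \<le> 2 ^ (16 * r ^ 2)"
    by (rule power_increasing) (use r4 in auto)
  finally have q_upper: "real q \<le> 2 ^ (16 * r ^ 2)" .
  have "real (2 * r + 1) \<le> 2 ^ (2 * r)"
  proof -
    have "2 * r < 2 ^ (2 * r)" by (rule less_exp)
    then have "real (Suc (2 * r)) \<le> real (2 ^ (2 * r))" by (intro of_nat_mono Suc_leI)
    then show ?thesis by simp
  qed
  also have "\<dots> \<le> 2 ^ (2 * r ^ 2)" by (rule power_increasing) (use rsq in auto)
  finally have "real w \<le> 2 ^ (16 * r ^ 2) * 2 ^ (2 * r ^ 2)"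
    unfolding w_def of_nat_mult by (intro mult_mono[OF q_upper]) auto
  also have "\<dots> = 2 ^ (18 * r ^ 2)" by (simp flip: power_add)
  finally have w_upper: "real w \<le> 2 ^ (18 * r ^ 2)" .
  have "q > 0" using q_lower(2) by (metis gr0I le_zero_eq power_not_zero zero_neq_numeral)
  then have wpos: "w > 0" by (simp add: w_def)
  then have "log 2 (real w) \<le> log 2 (2 ^ (18 * r ^ 2))"
    using w_upper by (subst log_le_cancel_iff) auto
  also have "\<dots> = 18 * real r ^ 2" by (simp add: log_nat_power)
  also have "\<dots> \<le> 648 / \<epsilon>" using r36 by simp
  finally show ?thesis using wpos suff by blast
qed

section \<open>Blow-ups of odd cycles\<close>

text \<open>The balanced blow-up of the cycle of length \<open>m\<close>: vertex \<open>v\<close> lies in class \<open>v mod m\<close>.\<close>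

definition cycle_blowup :: "nat \<Rightarrow> nat \<Rightarrow> graph" where
  "cycle_blowup m t = ({..<m * t}, {{u, v} |u v. u < m * t \<and> v < m * t \<and> v mod m = Suc u mod m})"

lemma adj_cycle_blowup:
  "(u, v) \<in> adj (cycle_blowup m t) \<longleftrightarrow>
     u < m * t \<and> v < m * t \<and> (v mod m = Suc u mod m \<or> u mod m = Suc v mod m)"
  by (auto simp: adj_def cycle_blowup_def doubleton_eq_iff)

lemma simple_cycle_blowup:
  assumes "m \<ge> 2"
  shows "simple_graph (cycle_blowup m t)"
proof -
  have "u mod m \<noteq> Suc u mod m" for u
    using assms by (simp add: mod_Suc)
  then show ?thesis
    by (auto simp: simple_graph_def cycle_blowup_def)
qed

text \<open>Every edge moves to an adjacent class, and \<open>s\<close> is the sum of these steps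
  \<open>+1\<close> and \<open>-1\<close>, taken in the integers rather than modulo
  \<open>m\<close>.\<close>

lemma cycle_blowup_walk_displacement:
  assumes "(x, y) \<in> adj (cycle_blowup m t) ^^ n"
  shows "\<exists>s. \<bar>s\<bar> \<le> int n \<and> (even s \<longleftrightarrow> even n) \<and> int m dvd int y - int x - s"
  using assms
proof (induction n arbitrary: y)
  case 0
  then show ?case by (intro exI[of _ 0]) auto
next
  case (Suc n)
  from Suc.prems obtain z where z: "(x, z) \<in> adj (cycle_blowup m t) ^^ n" "(z, y) \<in> adj (cycle_blowup m t)"
    by (rule relpow_Suc_E)
  from Suc.IH[OF z(1)] obtain s where
    s: "\<bar>s\<bar> \<le> int n" "even s \<longleftrightarrow> even n" "int m dvd int z - int x - s" by blast
  have step: "int m dvd int b - int a - 1" if "b mod m = Suc a mod m" for a b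
    using that by (metis diff_diff_eq mod_eq_dvd_iff of_nat_Suc of_nat_mod add.commute)
  from z(2) consider "y mod m = Suc z mod m" | "z mod m = Suc y mod m"
    by (auto simp: adj_cycle_blowup)
  then show ?case
  proof cases
    case 1
    from dvd_add[OF step[OF 1] s(3)] show ?thesis
      using s by (intro exI[of _ "s + 1"]) (auto simp: algebra_simps)
  next
    case 2
    from dvd_diff[OF s(3) step[OF 2]] show ?thesis
      using s by (intro exI[of _ "s - 1"]) (auto simp: algebra_simps)
  qed
qed

text \<open>On a closed walk the displacement is a multiple of \<open>m\<close>, and being smaller
  than \<open>m\<close> in absolute value it is \<open>0\<close>; but an odd number of unit steps
  has an odd sum.\<close>

lemma cycle_blowup_odd_girth:
  assumes "2 * j + 1 < m"
  shows "(x, x) \<notin> adj (cycle_blowup m t) ^^ (2 * j + 1)"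
proof
  assume "(x, x) \<in> adj (cycle_blowup m t) ^^ (2 * j + 1)"
  from cycle_blowup_walk_displacement[OF this] obtain s where
    s: "\<bar>s\<bar> \<le> int (2 * j + 1)" "odd s" "int m dvd s" by auto
  then have "s = 0" using assms dvd_imp_le_int[of s "int m"] by fastforce
  with s(2) show False by simp
qed

text \<open>For \<open>a, b < t\<close>, the closed walk of length \<open>2k + 1\<close> in the blow-up whose vertex in class \<open>i\<close>
  has the following index within its class. Two consecutive indices determine \<open>a\<close> and \<open>b\<close>, so these
  \<open>t\<^sup>2\<close> closed walks are pairwise edge-disjoint.\<close>

definition transversal_index :: "nat \<Rightarrow> nat \<Rightarrow> nat \<times> nat \<Rightarrow> nat \<Rightarrow> nat" where
  "transversal_index k t p i =
     (if i = 2 * k then (fst p + snd p) mod t else if even i then fst p else snd p)"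

text \<open>Index \<open>c\<close> in class \<open>j\<close> is the vertex
  \<open>c * (2 * k + 1) + j\<close>. Reducing \<open>i\<close> modulo \<open>2 * k + 1\<close>
  closes the walk after one round.\<close>

definition transversal :: "nat \<Rightarrow> nat \<Rightarrow> nat \<times> nat \<Rightarrow> nat \<Rightarrow> nat" where
  "transversal k t p i =
     transversal_index k t p (i mod (2 * k + 1)) * (2 * k + 1) + i mod (2 * k + 1)"

lemma transversal_mod: "transversal k t p i mod (2 * k + 1) = i mod (2 * k + 1)"
  unfolding transversal_def by (simp only: mod_mult_self3 mod_mod_trivial)

lemma transversal_div: "transversal k t p i div (2 * k + 1) = transversal_index k t p (i mod (2 * k + 1))"
  unfolding transversal_def by (subst div_mult_self3) simp_all

lemma transversal_less:
  assumes "p \<in> {..<t} \<times> {..<t}"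
  shows "transversal k t p i < (2 * k + 1) * t"
proof -
  let ?c = "transversal_index k t p (i mod (2 * k + 1))"
  have "?c < t" using assms by (auto simp: transversal_index_def)
  then have "(?c + 1) * (2 * k + 1) \<le> t * (2 * k + 1)" by (intro mult_right_mono) auto
  moreover have "i mod (2 * k + 1) < 2 * k + 1" by simp
  ultimately show ?thesis unfolding transversal_def by (simp only: algebra_simps)
qed

lemma add_mod_cancel:
  fixes a b c t :: nat
  assumes "(a + b) mod t = (c + b) mod t" "a < t" "c < t"
  shows "a = c"
proof -
  have "int t dvd int a - int c"
    using assms(1) by (metis add_diff_cancel_right mod_eq_dvd_iff of_nat_add of_nat_mod)
  then show ?thesis
    using assms(2,3) dvd_imp_le_int[of "int a - int c" "int t"] by fastforce
qed

lemma transversal_edge_disjoint: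
  assumes k: "k \<ge> 1" and p: "p \<in> {..<t} \<times> {..<t}" and p': "p' \<in> {..<t} \<times> {..<t}"
    and ij: "i < 2 * k + 1" "j < 2 * k + 1"
    and eq: "{transversal k t p i, transversal k t p (Suc i)} = {transversal k t p' j, transversal k t p' (Suc j)}"
  shows "p = p'"
proof -
  let ?m = "2 * k + 1"
  \<comment> \<open>Exchanged ends would make \<open>i\<close> and \<open>j\<close> successors of
    each other modulo \<open>2 * k + 1\<close>, which is at least \<open>3\<close>.\<close>
  have "transversal k t p i \<noteq> transversal k t p' (Suc j) \<or> transversal k t p (Suc i) \<noteq> transversal k t p' j"
  proof (rule ccontr)
    assume "\<not> ?thesis"
    then have "i mod ?m = Suc j mod ?m" "Suc i mod ?m = j mod ?m"
      using transversal_mod by metis+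
    then show False using ij k by (auto simp: mod_Suc split: if_splits)
  qed
  with eq have eqs: "transversal k t p i = transversal k t p' j" "transversal k t p (Suc i) = transversal k t p' (Suc j)"
    by (auto simp: doubleton_eq_iff)
  have "i mod ?m = j mod ?m" using eqs(1) transversal_mod by metis
  then have "i = j" using ij by simp
  with eqs have idx: "transversal_index k t p (i mod ?m) = transversal_index k t p' (i mod ?m)"
    "transversal_index k t p (Suc i mod ?m) = transversal_index k t p' (Suc i mod ?m)"
    using transversal_div by metis+
  \<comment> \<open>For \<open>p = (a, b)\<close> the consecutive indices are
    \<open>a + b, a\<close> in the first case, \<open>b, a + b\<close> in the second, with sums
    modulo \<open>t\<close>, and \<open>a\<close>, \<open>b\<close> in some order in the
    third.\<close>
  consider "i = 2 * k" | "Suc i = 2 * k" | "Suc i < 2 * k" using ij by linarith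
  then show ?thesis
  proof cases
    case 1
    then have "fst p = fst p'" "(fst p + snd p) mod t = (fst p' + snd p') mod t"
      using idx k by (auto simp: transversal_index_def)
    then show ?thesis
      using add_mod_cancel[of "snd p" "fst p" t "snd p'"] p p' by (auto simp: add.commute prod_eq_iff)
  next
    case 2
    then have "odd i" by (metis even_Suc even_mult_iff even_numeral)
    then have "snd p = snd p'" "(fst p + snd p) mod t = (fst p' + snd p') mod t"
      using idx 2 by (auto simp: transversal_index_def)
    then show ?thesis
      using add_mod_cancel[of "fst p" "snd p" t "fst p'"] p p' by (auto simp: prod_eq_iff)
  next
    case 3
    then show ?thesis
      using idx by (cases "even i") (auto simp: transversal_index_def prod_eq_iff)
  qed
qed

text \<open>Each of the \<open>t ^ 2\<close> edge-disjoint closed walks must lose an edge, since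
  \<open>2 ^ (k ^ 2) \<le> t\<close> makes their length forbidden. The order being
  \<open>(2 * k + 1) * t\<close>, this is the fraction \<open>1 / (2 * k + 1) ^ 2\<close> of its
  square.\<close>

lemma far_cycle_blowup:
  assumes k: "k \<ge> 1" and t: "2 ^ (k ^ 2) \<le> t" and \<epsilon>: "\<epsilon> \<le> 1 / real (2 * k + 1) ^ 2"
  shows "far_from \<epsilon> no_short_odd_cycle (cycle_blowup (2 * k + 1) t)"
  unfolding far_from_def
proof (intro allI impI)
  let ?m = "2 * k + 1"
  let ?G = "cycle_blowup ?m t"
  fix F
  assume F: "F \<subseteq> edges ?G" "remove_edges ?G F \<in> no_short_odd_cycle"
  have finF: "finite F"
  proof -
    have "simple_graph ?G" by (rule simple_cycle_blowup) (use k in simp)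
    then have "finite (edges ?G)"
      unfolding simple_graph_def using finite_imp_finite_nsets finite_subset by blast
    with F(1) show ?thesis by (rule finite_subset)
  qed
  have "t \<le> ?m * t" by simp
  then have "2 ^ (k ^ 2) \<le> card (verts (remove_edges ?G F))"
    using t by (simp add: remove_edges_def cycle_blowup_def)
  then have nw: "(x, x) \<notin> adj (remove_edges ?G F) ^^ ?m" for x
    using F(2) unfolding no_short_odd_cycle_def by blast
  have "\<exists>i<?m. {transversal k t p i, transversal k t p (Suc i)} \<in> F" if p: "p \<in> {..<t} \<times> {..<t}" for p
  proof (rule ccontr)
    let ?f = "transversal k t p"
    assume "\<not> ?thesis"
    moreover have "(?f i, ?f (Suc i)) \<in> adj ?G" for i
    proof -
      have "?f (Suc i) mod ?m = Suc (?f i) mod ?m"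
        by (metis transversal_mod mod_Suc_eq)
      then show ?thesis
        using transversal_less[OF p] by (simp add: adj_cycle_blowup)
    qed
    ultimately have "\<forall>i<?m. (?f i, ?f (Suc i)) \<in> adj (remove_edges ?G F)"
      by (auto simp: adj_def remove_edges_def)
    moreover have "?f ?m = ?f 0" by (simp add: transversal_def)
    ultimately have "(?f 0, ?f 0) \<in> adj (remove_edges ?G F) ^^ ?m"
      unfolding relpow_fun_conv by blast
    with nw show False by blast
  qed
  then obtain \<phi> where \<phi>: "\<And>p. p \<in> {..<t} \<times> {..<t} \<Longrightarrow>
      \<phi> p < ?m \<and> {transversal k t p (\<phi> p), transversal k t p (Suc (\<phi> p))} \<in> F"
    by metis
  let ?h = "\<lambda>p. {transversal k t p (\<phi> p), transversal k t p (Suc (\<phi> p))}"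
  have "inj_on ?h ({..<t} \<times> {..<t})"
  proof (rule inj_onI)
    fix p q
    assume pq: "p \<in> {..<t} \<times> {..<t}" "q \<in> {..<t} \<times> {..<t}" and "?h p = ?h q"
    with \<phi>[OF pq(1)] \<phi>[OF pq(2)] show "p = q"
      by (intro transversal_edge_disjoint[OF k pq]) auto
  qed
  then have "card ({..<t} \<times> {..<t}) \<le> card F"
    by (rule card_inj_on_le) (use \<phi> finF in auto)
  then have "t ^ 2 \<le> card F" by (simp add: card_cartesian_product power2_eq_square)
  then have le: "real t ^ 2 \<le> real (card F)" by (metis of_nat_le_iff of_nat_power)
  have "\<epsilon> * (real ?m * real t) ^ 2 \<le> 1 / real ?m ^ 2 * (real ?m * real t) ^ 2"
    by (rule mult_right_mono[OF \<epsilon>]) simp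
  also have "\<dots> = real t ^ 2" by (simp add: power_mult_distrib)
  also note le
  finally show "\<epsilon> * (real (card (verts ?G)))\<^sup>2 \<le> real (card F)"
    by (simp only: cycle_blowup_def fst_conv card_lessThan of_nat_mult)
qed

text \<open>In a sample of fewer than \<open>2 ^ (k ^ 2)\<close> vertices only lengths
  \<open>2 * j + 1\<close> with \<open>j < k\<close> are forbidden, and the blow-up has no such
  closed walk. So the far blow-up is never rejected.\<close>

lemma sample_size_lower:
  assumes k: "k \<ge> 1" and \<epsilon>: "\<epsilon> \<le> 1 / real (2 * k + 1) ^ 2"
    and suff: "sample_size_suffices no_short_odd_cycle \<epsilon> w"
  shows "2 ^ (k ^ 2) \<le> w"
proof (rule ccontr)
  assume "\<not> ?thesis"
  then have w: "w < 2 ^ (k ^ 2)" by simp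
  let ?m = "2 * k + 1"
  obtain n0 where n0: "\<And>G. simple_graph G \<Longrightarrow> n0 \<le> card (verts G) \<Longrightarrow> far_from \<epsilon> no_short_odd_cycle G \<Longrightarrow>
      2 / 3 \<le> measure_pmf.prob (pmf_of_set (nsets (verts G) w)) {S. induced_subgraph G S \<notin> no_short_odd_cycle}"
    using suff unfolding sample_size_suffices_def by blast
  \<comment> \<open>The summand \<open>n0\<close> brings the blow-up into the range of the
    guarantee; \<open>2 ^ (k ^ 2)\<close> makes it far and larger than the sample.\<close>
  define t where "t = n0 + 2 ^ (k ^ 2)"
  define G where "G = cycle_blowup ?m t"
  have G: "simple_graph G" using simple_cycle_blowup k by (simp add: G_def)
  have "t \<le> ?m * t" by simp
  then have t: "t \<le> card (verts G)" by (simp add: G_def cycle_blowup_def)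
  have "far_from \<epsilon> no_short_odd_cycle G"
    unfolding G_def by (rule far_cycle_blowup[OF k _ \<epsilon>]) (simp add: t_def)
  moreover have "n0 \<le> card (verts G)" using t by (simp add: t_def)
  ultimately have prob: "2 / 3 \<le>
      measure_pmf.prob (pmf_of_set (nsets (verts G) w)) {S. induced_subgraph G S \<notin> no_short_odd_cycle}"
    by (intro n0[OF G])
  have fin: "finite (verts G)" using G by (simp add: simple_graph_def)
  have "w \<le> card (verts G)" using w t by (simp add: t_def)
  then have set: "set_pmf (pmf_of_set (nsets (verts G) w)) = nsets (verts G) w"
    using fin by (intro set_pmf_of_set) (auto simp: nsets_eq_empty_iff finite_imp_finite_nsets)
  have "induced_subgraph G S \<in> no_short_odd_cycle" if S: "S \<in> nsets (verts G) w" for S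
  proof -
    have "(x, x) \<notin> adj (induced_subgraph G S) ^^ (2 * j + 1)"
      if "2 ^ (j ^ 2) \<le> card (verts (induced_subgraph G S))" for j x
    proof -
      have "2 ^ (j ^ 2) \<le> w"
        using that S by (simp add: induced_subgraph_def nsets_def)
      then have "(2::nat) ^ (j ^ 2) < 2 ^ (k ^ 2)"
        using w by (rule le_less_trans)
      then have "j ^ 2 < k ^ 2" by (rule power_less_imp_less_exp[rotated]) simp
      then have "j < k" by (rule power_less_imp_less_base) simp
      then have "(x, x) \<notin> adj G ^^ (2 * j + 1)"
        unfolding G_def by (intro cycle_blowup_odd_girth) simp
      then show ?thesis
        unfolding adj_induced_subgraph using relpow_mono_rel[of "adj G \<inter> S \<times> S" "adj G"] by blast
    qed
    moreover have "simple_graph (induced_subgraph G S)"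
      by (rule simple_induced_subgraph[OF G]) (use S in \<open>simp add: nsets_def\<close>)
    ultimately show ?thesis unfolding no_short_odd_cycle_def by blast
  qed
  then have "measure_pmf.prob (pmf_of_set (nsets (verts G) w)) {S. induced_subgraph G S \<notin> no_short_odd_cycle} = 0"
    unfolding measure_pmf_zero_iff set by blast
  with prob show False by simp
qed

section \<open>The query complexity\<close>

lemma query_complexity_upper:
  assumes "0 < \<epsilon>" "\<epsilon> < 1"
  shows "query_complexity no_short_odd_cycle \<epsilon> > 0"
    and "sample_size_suffices no_short_odd_cycle \<epsilon> (query_complexity no_short_odd_cycle \<epsilon>)"
    and "log 2 (real (query_complexity no_short_odd_cycle \<epsilon>)) \<le> 648 / \<epsilon>"
proof -
  obtain w where w: "w > 0" "sample_size_suffices no_short_odd_cycle \<epsilon> w" "log 2 (real w) \<le> 648 / \<epsilon>"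
    using sample_size_upper[OF assms] by blast
  have "query_complexity no_short_odd_cycle \<epsilon> > 0 \<and>
      sample_size_suffices no_short_odd_cycle \<epsilon> (query_complexity no_short_odd_cycle \<epsilon>)"
    unfolding query_complexity_def by (rule LeastI[of _ w]) (use w in auto)
  then show pos: "query_complexity no_short_odd_cycle \<epsilon> > 0"
    and "sample_size_suffices no_short_odd_cycle \<epsilon> (query_complexity no_short_odd_cycle \<epsilon>)" by auto
  have "query_complexity no_short_odd_cycle \<epsilon> \<le> w"
    unfolding query_complexity_def by (rule Least_le) (use w in auto)
  then have "log 2 (real (query_complexity no_short_odd_cycle \<epsilon>)) \<le> log 2 (real w)"
    using pos by (subst log_le_cancel_iff) auto
  with w(3) show "log 2 (real (query_complexity no_short_odd_cycle \<epsilon>)) \<le> 648 / \<epsilon>" by linarith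
qed

lemma query_complexity_lower:
  assumes "0 < \<epsilon>" "\<epsilon> < 1 / 36"
  shows "1 / (16 * \<epsilon>) \<le> log 2 (real (query_complexity no_short_odd_cycle \<epsilon>))"
proof -
  define s where "s = 1 / sqrt \<epsilon>"
  have "sqrt \<epsilon> < sqrt (1 / 36)" using assms by (intro real_sqrt_less_mono)
  also have "sqrt (1 / 36) = (1 / 6 :: real)" by (rule real_sqrt_unique) (auto simp: power2_eq_square)
  finally have s6: "s > 6" using assms by (simp add: s_def field_simps)
  have s2: "s ^ 2 = 1 / \<epsilon>" using assms by (simp add: s_def power_divide)
  \<comment> \<open>This is the largest \<open>k\<close> with \<open>2 * k + 1 \<le> s\<close>, so
    the blow-up is still far. Rounding leaves \<open>k > (s - 3) / 2\<close>, which is at least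
    \<open>s / 4\<close> once \<open>s \<ge> 6\<close>; hence the bound \<open>1 / 36\<close> on
    \<open>\<epsilon>\<close>.\<close>
  define k where "k = nat \<lfloor>(s - 1) / 2\<rfloor>"
  have "real k = of_int \<lfloor>(s - 1) / 2\<rfloor>"
    using s6 by (simp add: k_def)
  then have "real k \<le> (s - 1) / 2" "(s - 1) / 2 < real k + 1"
    by linarith+
  then have k_upper: "real (2 * k + 1) \<le> s" and k_lower: "s / 4 \<le> real k"
    using s6 by simp_all
  then have k1: "k \<ge> 1" using s6 by linarith
  have "real (2 * k + 1) ^ 2 \<le> 1 / \<epsilon>"
    unfolding s2[symmetric] by (rule power_mono[OF k_upper]) simp
  then have "\<epsilon> \<le> 1 / real (2 * k + 1) ^ 2"
    using assms by (simp add: field_simps)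
  then have "2 ^ (k ^ 2) \<le> query_complexity no_short_odd_cycle \<epsilon>"
    by (rule sample_size_lower[OF k1]) (use query_complexity_upper(2) assms in auto)
  then have "2 ^ (k ^ 2) \<le> real (query_complexity no_short_odd_cycle \<epsilon>)"
    by (metis of_nat_le_iff of_nat_numeral of_nat_power)
  then have "log 2 (2 ^ (k ^ 2)) \<le> log 2 (real (query_complexity no_short_odd_cycle \<epsilon>))"
    by (intro log_mono) auto
  then have "real k ^ 2 \<le> log 2 (real (query_complexity no_short_odd_cycle \<epsilon>))"
    by (simp add: log_nat_power)
  moreover have "(s / 4) ^ 2 \<le> real k ^ 2" by (rule power_mono[OF k_lower]) (use s6 in simp)
  then have "1 / (16 * \<epsilon>) \<le> real k ^ 2" by (simp add: power_divide s2)
  ultimately show ?thesis by linarith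
qed

theorem theorem4:
  "\<exists>P. monotone_graph_property P \<and>
       (\<forall>\<epsilon>\<in>{0<..<1}. \<exists>w>0. sample_size_suffices P \<epsilon> w) \<and>
       (\<exists>f \<in> \<Theta>[at_right 0](\<lambda>\<epsilon>::real. 1 / \<epsilon>).
          \<forall>\<epsilon>\<in>{0<..<1}. real (query_complexity P \<epsilon>) = 2 powr (f \<epsilon> :: real))"
proof (intro exI[of _ no_short_odd_cycle] conjI)
  let ?f = "\<lambda>\<epsilon>. log 2 (real (query_complexity no_short_odd_cycle \<epsilon>))"
  show "monotone_graph_property no_short_odd_cycle"
    by (rule monotone_no_short_odd_cycle)
  show "\<forall>\<epsilon>\<in>{0<..<1}. \<exists>w>0. sample_size_suffices no_short_odd_cycle \<epsilon> w"
    using query_complexity_upper(1,2) by (meson greaterThanLessThan_iff)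
  have ev: "\<forall>\<^sub>F \<epsilon>::real in at_right 0. 0 < \<epsilon> \<and> \<epsilon> < 1 / 36"
    unfolding eventually_at_right_field by (intro exI[of _ "1 / 36"]) auto
  have "?f \<in> \<Theta>[at_right 0](\<lambda>\<epsilon>. 1 / \<epsilon>)"
  proof (rule bigthetaI)
    show "?f \<in> O[at_right 0](\<lambda>\<epsilon>. 1 / \<epsilon>)"
    proof (rule bigoI)
      show "\<forall>\<^sub>F \<epsilon> in at_right 0. norm (?f \<epsilon>) \<le> 648 * norm (1 / \<epsilon>)"
        using ev
      proof eventually_elim
        case (elim \<epsilon>)
        \<comment> \<open>The lower bound makes the logarithm nonnegative, so it equals its
          norm.\<close>
        then have "0 \<le> 1 / (16 * \<epsilon>)" by simp
        with elim query_complexity_lower[of \<epsilon>] query_complexity_upper(3)[of \<epsilon>]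
        show ?case by simp
      qed
    qed
    show "?f \<in> \<Omega>[at_right 0](\<lambda>\<epsilon>. 1 / \<epsilon>)"
    proof (rule landau_omega.bigI)
      show "\<forall>\<^sub>F \<epsilon> in at_right 0. norm (?f \<epsilon>) \<ge> 1 / 16 * norm (1 / \<epsilon>)"
        using ev by eventually_elim (use query_complexity_lower in force)
    qed simp
  qed
  moreover have "\<forall>\<epsilon>\<in>{0<..<1}. real (query_complexity no_short_odd_cycle \<epsilon>) = 2 powr ?f \<epsilon>"
    using query_complexity_upper(1) by auto
  ultimately show "\<exists>f \<in> \<Theta>[at_right 0](\<lambda>\<epsilon>::real. 1 / \<epsilon>).
      \<forall>\<epsilon>\<in>{0<..<1}. real (query_complexity no_short_odd_cycle \<epsilon>) = 2 powr (f \<epsilon> :: real)"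
    by (intro bexI[of _ ?f])
qed

end
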